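(* Let $n,d$ be positive integers with $n\ge4d$, and let $\boldsymbol{X}=\langle X_i:i\in[n]^d\rangle$ be an exchangeable and symmetric random tensor whose diagonal terms vanish and whose entries have finite third moment. (1) If $\boldsymbol{X}$ is dissociated, then $$\mathrm{osc}(\boldsymbol{X})\le\frac{16d\,\big(\mathbb{E}[|X_{(1,\dots,d)}|^3]+1\big)}{\sqrt[4]n}.$$ (2) If $\boldsymbol{X}$ is a mixture of dissociated, exchangeable and symmetric random tensors, then $$\mathrm{osc}(\boldsymbol{X})\le\sqrt{\mathrm{pc}(\boldsymbol{X})}+\frac{16d\,\big(\mathbb{E}[|X_{(1,\dots,d)}|^3]+1\big)}{\sqrt[4]n}.$$
   Context: $[n]=\{1,\dots,n\}$; elements $i\in[n]^d$ are viewed as functions $[d]\to[n]$ with $r$-th entry $i(r)$. An index is diagonal if its entries are not pairwise distinct; diagonal terms vanish if the entry at every diagonal index is $0$. $\boldsymbol{X}$ is symmetric if $X_{(i_1,\dots,i_d)}=X_{(i_{\tau(1)},\dots,i_{\tau(d)})}$ for every index and every permutation $\tau$ of $[d]$. It is exchangeable if for every permutation $\pi$ of $[n]$ the random tensors $\boldsymbol{X}$ and $\langle X_{\pi\circ i}:i\in[n]^d\rangle$ have the same distribution, where $\pi\circ i=(\pi(i_1),\dots,\pi(i_d))$. It is dissociated if for every pair $K,L$ of disjoint subsets of $[n]$ with $|K|,|L|\ge d$ the random tensors $\langle X_i:i\in K^d\rangle$ and $\langle X_i:i\in L^d\rangle$ are independent. $\boldsymbol{X}$ is a mixture of random tensors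 $\langle\boldsymbol{X}_\omega:\omega\in\Omega\rangle$, with respect to a probability space $(\Omega,\mathcal{F},\mathbf{P})$, if $\mathbb{P}(\boldsymbol{X}\in A)=\int_\Omega\mathbb{P}(\boldsymbol{X}_\omega\in A)\,d\mathbf{P}(\omega)$ for every Borel $A\subseteq\mathbb{R}^{[n]^d}$ (measurable dependence of the law of $\boldsymbol{X}_\omega$ on $\omega$ is assumed). $\delta_1:=\mathbb{E}[X_{(1,\dots,d)}X_{(1,d+1,\dots,2d-1)}]$ (so $\delta_1=\mathbb{E}[X_1^2]$ if $d=1$). The oscillation is $$\mathrm{osc}(\boldsymbol{X}):=\mathbb{E}\Big|\frac1n\sum_{j=1}^n\Big(\frac1{n^{d-1}}\sum_{i\in[n]^d,\ i(1)=j}X_i\Big)^2-\delta_1\Big|.$$ The parallelepipedal correlation is $$\mathrm{pc}(\boldsymbol{X}):=\big|\mathbb{E}[X_{(1,\dots,d)}X_{(1,d+1,\dots,2d-1)}X_{(2d,\dots,3d-1)}X_{(2d,3d,\dots,4d-2)}]-\delta_1^2\big|$$ (so $\mathrm{pc}(\boldsymbol{X})=|\mathbb{E}[X_1^2X_2^2]-\delta_1^2|$ if $d=1$); in (2) it is understood that this expectation exists, i.e. that the product of the four entries is integrable. *)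

theory Defs
  imports "HOL-Probability.Probability"
begin

text \<open>
  An element of \<open>K\<^sup>d\<close> is an extensional function on \<open>{1..d}\<close> with values in \<open>K\<close>.  A tensor indexed
  by \<open>K\<^sup>d\<close> is a function on multi-indices of which only the values on \<open>K\<^sup>d\<close> matter, and a random
  tensor on \<open>M\<close> is a family of random variables \<open>X i\<close> on \<open>M\<close>.
\<close>

definition indices :: "nat \<Rightarrow> nat set \<Rightarrow> (nat \<Rightarrow> nat) set" where
  "indices d K = {1..d} \<rightarrow>\<^sub>E K"

text \<open>The multi-index \<open>(x\<^sub>1, \<dots>, x\<^sub>d)\<close> written as the list \<open>[x\<^sub>1, \<dots>, x\<^sub>d]\<close>.\<close>

definition tup :: "nat list \<Rightarrow> nat \<Rightarrow> nat" where
  "tup xs = (\<lambda>r\<in>{1..length xs}. xs ! (r - 1))"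

definition random_tensor :: "'a measure \<Rightarrow> nat \<Rightarrow> nat \<Rightarrow> ((nat \<Rightarrow> nat) \<Rightarrow> 'a \<Rightarrow> real) \<Rightarrow> bool" where
  "random_tensor M n d X \<longleftrightarrow>
     prob_space M \<and> (\<forall>i\<in>indices d {1..n}. X i \<in> borel_measurable M)"

text \<open>Since \<open>indices d K\<close> is finite for finite \<open>K\<close>, the product sigma-algebra below is the Borel
  sigma-algebra of the Euclidean space of tensors indexed by \<open>K\<^sup>d\<close>.\<close>

definition tensor_space :: "nat \<Rightarrow> nat set \<Rightarrow> ((nat \<Rightarrow> nat) \<Rightarrow> real) measure" where
  "tensor_space d K = PiM (indices d K) (\<lambda>_. borel)"

definition subtensor ::
    "nat \<Rightarrow> nat set \<Rightarrow> ((nat \<Rightarrow> nat) \<Rightarrow> 'a \<Rightarrow> real) \<Rightarrow> 'a \<Rightarrow> ((nat \<Rightarrow> nat) \<Rightarrow> real)" where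
  "subtensor d K X \<omega> = (\<lambda>i\<in>indices d K. X i \<omega>)"

definition tensor_law ::
    "'a measure \<Rightarrow> nat \<Rightarrow> nat \<Rightarrow> ((nat \<Rightarrow> nat) \<Rightarrow> 'a \<Rightarrow> real) \<Rightarrow> ((nat \<Rightarrow> nat) \<Rightarrow> real) measure" where
  "tensor_law M n d X = distr M (tensor_space d {1..n}) (subtensor d {1..n} X)"

text \<open>Equalities between random variables are understood almost surely, here and in \<open>symmetric\<close>.\<close>

definition diagonal_vanish :: "'a measure \<Rightarrow> nat \<Rightarrow> nat \<Rightarrow> ((nat \<Rightarrow> nat) \<Rightarrow> 'a \<Rightarrow> real) \<Rightarrow> bool" where
  "diagonal_vanish M n d X \<longleftrightarrow>
     (\<forall>i\<in>indices d {1..n}. \<not> inj_on i {1..d} \<longrightarrow> (AE \<omega> in M. X i \<omega> = 0))"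

definition symmetric :: "'a measure \<Rightarrow> nat \<Rightarrow> nat \<Rightarrow> ((nat \<Rightarrow> nat) \<Rightarrow> 'a \<Rightarrow> real) \<Rightarrow> bool" where
  "symmetric M n d X \<longleftrightarrow>
     (\<forall>i\<in>indices d {1..n}. \<forall>\<tau>. \<tau> permutes {1..d} \<longrightarrow>
        (AE \<omega> in M. X i \<omega> = X (compose {1..d} i \<tau>) \<omega>))"

definition exchangeable :: "'a measure \<Rightarrow> nat \<Rightarrow> nat \<Rightarrow> ((nat \<Rightarrow> nat) \<Rightarrow> 'a \<Rightarrow> real) \<Rightarrow> bool" where
  "exchangeable M n d X \<longleftrightarrow>
     (\<forall>\<pi>. \<pi> permutes {1..n} \<longrightarrow>
        tensor_law M n d X = tensor_law M n d (\<lambda>i. X (compose {1..d} \<pi> i)))"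

definition dissociated :: "'a measure \<Rightarrow> nat \<Rightarrow> nat \<Rightarrow> ((nat \<Rightarrow> nat) \<Rightarrow> 'a \<Rightarrow> real) \<Rightarrow> bool" where
  "dissociated M n d X \<longleftrightarrow>
     (\<forall>K L. K \<subseteq> {1..n} \<and> L \<subseteq> {1..n} \<and> K \<inter> L = {} \<and> d \<le> card K \<and> d \<le> card L \<longrightarrow>
        prob_space.indep_var M
          (tensor_space d K) (subtensor d K X) (tensor_space d L) (subtensor d L X))"

text \<open>\<open>X\<close> is the mixture, with respect to the probability space \<open>P\<close>, of the random tensors \<open>Y w\<close>
  for \<open>w \<in> space P\<close>, each of which lives on its own probability space \<open>N w\<close>.\<close>

definition is_mixture ::
    "'a measure \<Rightarrow> nat \<Rightarrow> nat \<Rightarrow> ((nat \<Rightarrow> nat) \<Rightarrow> 'a \<Rightarrow> real) \<Rightarrow>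
     'w measure \<Rightarrow> ('w \<Rightarrow> 'b measure) \<Rightarrow> ('w \<Rightarrow> (nat \<Rightarrow> nat) \<Rightarrow> 'b \<Rightarrow> real) \<Rightarrow> bool" where
  "is_mixture M n d X P N Y \<longleftrightarrow>
     prob_space P \<and>
     (\<forall>w\<in>space P. random_tensor (N w) n d (Y w)) \<and>
     (\<lambda>w. tensor_law (N w) n d (Y w)) \<in> measurable P (prob_algebra (tensor_space d {1..n})) \<and>
     (\<forall>A\<in>sets (tensor_space d {1..n}).
        measure (tensor_law M n d X) A = (LINT w|P. measure (tensor_law (N w) n d (Y w)) A))"

definition delta1 :: "'a measure \<Rightarrow> nat \<Rightarrow> ((nat \<Rightarrow> nat) \<Rightarrow> 'a \<Rightarrow> real) \<Rightarrow> real" where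
  "delta1 M d X = (LINT \<omega>|M. X (tup [1..<d+1]) \<omega> * X (tup (1 # [d+1..<2*d])) \<omega>)"

definition osc :: "'a measure \<Rightarrow> nat \<Rightarrow> nat \<Rightarrow> ((nat \<Rightarrow> nat) \<Rightarrow> 'a \<Rightarrow> real) \<Rightarrow> real" where
  "osc M n d X =
     (LINT \<omega>|M. \<bar>1 / real n *
         (\<Sum>j=1..n. (1 / real n ^ (d - 1) * (\<Sum>i\<in>{i\<in>indices d {1..n}. i 1 = j}. X i \<omega>))\<^sup>2)
       - delta1 M d X\<bar>)"

definition pc_product :: "nat \<Rightarrow> ((nat \<Rightarrow> nat) \<Rightarrow> 'a \<Rightarrow> real) \<Rightarrow> 'a \<Rightarrow> real" where
  "pc_product d X \<omega> =
     X (tup [1..<d+1]) \<omega> * X (tup (1 # [d+1..<2*d])) \<omega> *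
     X (tup [2*d..<3*d]) \<omega> * X (tup (2*d # [3*d..<4*d-1])) \<omega>"

definition pc :: "'a measure \<Rightarrow> nat \<Rightarrow> ((nat \<Rightarrow> nat) \<Rightarrow> 'a \<Rightarrow> real) \<Rightarrow> real" where
  "pc M d X = \<bar>(LINT \<omega>|M. pc_product d X \<omega>) - (delta1 M d X)\<^sup>2\<bar>"

end

theory Submission
  imports Defs
begin

text \<open>
  The mean of squares in the oscillation is the average of the products
  \<open>Z\<^sub>a = X (a\<^sub>1, \<dots>, a\<^sub>d) X (a\<^sub>1, a\<^sub>d\<^sub>+\<^sub>1, \<dots>, a\<^sub>2\<^sub>d\<^sub>-\<^sub>1)\<close> over all \<open>a\<close>.  For injective \<open>a\<close>
  exchangeability gives \<open>E Z\<^sub>a = \<delta>\<^sub>1\<close>, and only a fraction \<open>O(d\<^sup>2 / n)\<close> of the \<open>a\<close> is not injective.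
  Dissociation makes \<open>Z\<^sub>a\<close> and \<open>Z\<^sub>b\<close> uncorrelated unless \<open>a\<close> and \<open>b\<close> share a value, which
  happens for a fraction \<open>O(d\<^sup>2 / n)\<close> of the pairs, so Chebyshev's argument applies.  As only third
  moments are available, the entries are first truncated at level \<open>\<surd>n\<close>.

  For a mixture, the oscillation around \<open>\<delta>\<^sub>1(X)\<close> is at most the average of \<open>osc(Y\<^sub>w)\<close> plus the average
  of \<open>\<bar>\<delta>\<^sub>1(Y\<^sub>w) - \<delta>\<^sub>1(X)\<bar>\<close>.  Since a dissociated tensor has \<open>pc = 0\<close>, the variance of \<open>\<delta>\<^sub>1(Y\<^sub>w)\<close>
  over \<open>w\<close> is the parallelepipedal correlation of \<open>X\<close>.
\<close>

section \<open>Counting and permuting index maps\<close>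

text \<open>Forgetting coordinate \<open>r\<close> is injective on this set, because
  \<open>h\<close> recovers it from the others. A general \<open>h\<close> covers both a value
  repeated from another coordinate and a value prescribed from outside.\<close>

lemma card_PiE_determined_le:
  fixes I :: "'i set" and K :: "'k set"
  assumes "finite I" "finite K" "r \<in> I"
  shows "card {a \<in> I \<rightarrow>\<^sub>E K. a r = h (restrict a (I - {r}))} \<le> card K ^ (card I - 1)"
proof -
  let ?A = "{a \<in> I \<rightarrow>\<^sub>E K. a r = h (restrict a (I - {r}))}"
  have "inj_on (\<lambda>a. restrict a (I - {r})) ?A"
  proof (rule inj_onI)
    fix a b assume a: "a \<in> ?A" and b: "b \<in> ?A"
      and eq: "restrict a (I - {r}) = restrict b (I - {r})"
    have "a x = b x" if "x \<in> I" for x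
    proof (cases "x = r")
      case True
      then show ?thesis using a b eq by simp
    next
      case False
      then show ?thesis using fun_cong[OF eq, of x] that by simp
    qed
    then show "a = b" using a b by (intro PiE_ext[of a I "\<lambda>_. K" b]) auto
  qed
  moreover have "(\<lambda>a. restrict a (I - {r})) ` ?A \<subseteq> (I - {r}) \<rightarrow>\<^sub>E K"
    by (auto simp: restrict_PiE_iff PiE_def Pi_def)
  ultimately have "card ?A \<le> card ((I - {r}) \<rightarrow>\<^sub>E K)"
    using assms by (intro card_inj_on_le) (auto intro: finite_PiE)
  also have "\<dots> = card K ^ (card I - 1)"
    using assms by (simp add: card_funcsetE)
  finally show ?thesis .
qed

text \<open>Union bound over the pairs of positions at which a value is repeated; each repetition
  determines one coordinate from the others.\<close>

lemma card_PiE_not_inj_le: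
  fixes I :: "'i set" and K :: "'k set"
  assumes "finite I" "finite K"
  shows "card {a \<in> I \<rightarrow>\<^sub>E K. \<not> inj_on a I} \<le> (card I)\<^sup>2 * card K ^ (card I - 1)"
proof -
  \<comment> \<open>For \<open>s = r\<close> the restriction returns \<open>undefined\<close>, so
    \<open>?E r r\<close> fixes one value and obeys the same bound. The union can therefore run over
    all of \<open>I \<times> I\<close>.\<close>
  let ?E = "\<lambda>r s. {a \<in> I \<rightarrow>\<^sub>E K. a r = (restrict a (I - {r})) s}"
  have fin: "finite (I \<rightarrow>\<^sub>E K)" using assms by (auto intro: finite_PiE)
  have "{a \<in> I \<rightarrow>\<^sub>E K. \<not> inj_on a I} \<subseteq> (\<Union>(r, s)\<in>I \<times> I. ?E r s)"
  proof
    fix a assume "a \<in> {a \<in> I \<rightarrow>\<^sub>E K. \<not> inj_on a I}"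
    then obtain r s where "a \<in> I \<rightarrow>\<^sub>E K" "r \<in> I" "s \<in> I" "r \<noteq> s" "a r = a s"
      by (auto simp: inj_on_def)
    then have "a \<in> ?E r s" "(r, s) \<in> I \<times> I" by auto
    then show "a \<in> (\<Union>(r, s)\<in>I \<times> I. ?E r s)" by blast
  qed
  then have "card {a \<in> I \<rightarrow>\<^sub>E K. \<not> inj_on a I} \<le> card (\<Union>(r, s)\<in>I \<times> I. ?E r s)"
    using assms fin by (intro card_mono) auto
  also have "\<dots> \<le> (\<Sum>(r, s)\<in>I \<times> I. card (?E r s))"
    using card_UN_le[of "I \<times> I" "\<lambda>(r, s). ?E r s"] assms by (simp add: case_prod_beta)
  also have "\<dots> \<le> (\<Sum>(r, s)\<in>I \<times> I. card K ^ (card I - 1))"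
    using card_PiE_determined_le[OF assms, of _ "\<lambda>c. c s" for s]
    by (intro sum_mono) (simp only: mem_Times_iff split_beta)
  also have "\<dots> = (card I)\<^sup>2 * card K ^ (card I - 1)"
    by (simp add: card_cartesian_product power2_eq_square)
  finally show ?thesis .
qed

text \<open>Once \<open>b\<close> and the positions \<open>r\<close>, \<open>s\<close> of a common
  value are chosen, coordinate \<open>r\<close> of \<open>a\<close> is determined.\<close>

lemma card_PiE_pairs_meeting_le:
  fixes I :: "'i set" and K :: "'k set"
  assumes "finite I" "finite K"
  shows "card {(a, b) \<in> (I \<rightarrow>\<^sub>E K) \<times> (I \<rightarrow>\<^sub>E K). a ` I \<inter> b ` I \<noteq> {}}
    \<le> (card I)\<^sup>2 * card K ^ (card I - 1) * card K ^ card I"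
proof -
  let ?A = "I \<rightarrow>\<^sub>E K"
  let ?E = "\<lambda>b r s. {a \<in> ?A. a r = (b s :: 'k)}"
  have fin: "finite ?A" using assms by (auto intro: finite_PiE)
  have "{(a, b) \<in> ?A \<times> ?A. a ` I \<inter> b ` I \<noteq> {}}
      \<subseteq> (\<Union>(b, r, s)\<in>?A \<times> I \<times> I. (\<lambda>a. (a, b)) ` ?E b r s)"
  proof
    fix ab assume "ab \<in> {(a, b) \<in> ?A \<times> ?A. a ` I \<inter> b ` I \<noteq> {}}"
    then obtain a b r s where "ab = (a, b)" "a \<in> ?A" "b \<in> ?A" "r \<in> I" "s \<in> I" "a r = b s"
      by auto
    then have "ab \<in> (\<lambda>a. (a, b)) ` ?E b r s" "(b, r, s) \<in> ?A \<times> I \<times> I" by auto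
    then show "ab \<in> (\<Union>(b, r, s)\<in>?A \<times> I \<times> I. (\<lambda>a. (a, b)) ` ?E b r s)" by blast
  qed
  then have "card {(a, b) \<in> ?A \<times> ?A. a ` I \<inter> b ` I \<noteq> {}}
      \<le> card (\<Union>(b, r, s)\<in>?A \<times> I \<times> I. (\<lambda>a. (a, b)) ` ?E b r s)"
    using assms fin by (intro card_mono) auto
  also have "\<dots> \<le> (\<Sum>(b, r, s)\<in>?A \<times> I \<times> I. card ((\<lambda>a. (a, b)) ` ?E b r s))"
    using card_UN_le[of "?A \<times> I \<times> I" "\<lambda>(b, r, s). (\<lambda>a. (a, b)) ` ?E b r s"] assms fin
    by (simp add: case_prod_beta)
  also have "\<dots> \<le> (\<Sum>(b, r, s)\<in>?A \<times> I \<times> I. card K ^ (card I - 1))"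
  proof (intro sum_mono, clarify)
    fix b r s assume "r \<in> I"
    have "card ((\<lambda>a. (a, b)) ` ?E b r s) \<le> card (?E b r s)"
      using fin by (intro card_image_le) auto
    also have "\<dots> \<le> card K ^ (card I - 1)"
      using card_PiE_determined_le[OF assms \<open>r \<in> I\<close>, of "\<lambda>_. b s"] by simp
    finally show "card ((\<lambda>a. (a, b)) ` ?E b r s) \<le> card K ^ (card I - 1)" .
  qed
  also have "\<dots> = (card I)\<^sup>2 * card K ^ (card I - 1) * card K ^ card I"
    using assms by (simp add: card_cartesian_product power2_eq_square card_funcsetE)
  finally show ?thesis .
qed

text \<open>The complements of \<open>A\<close> and of its image have equal size, so
  \<open>f\<close> can be glued to a bijection between them. This lets exchangeability, stated for
  permutations of all of \<open>{1..n}\<close>, act on a single injective index.\<close>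

lemma inj_on_extends_to_permutation:
  assumes "finite S" "A \<subseteq> S" "f ` A \<subseteq> S" "inj_on f A"
  obtains p where "p permutes S" "\<And>x. x \<in> A \<Longrightarrow> p x = f x"
proof -
  have "card (S - A) = card (S - f ` A)"
    using assms by (simp add: card_Diff_subset card_image finite_subset)
  then obtain g where g: "bij_betw g (S - A) (S - f ` A)"
    using assms(1) finite_same_card_bij[of "S - A" "S - f ` A"] by auto
  define p where "p x = (if x \<in> A then f x else if x \<in> S then g x else x)" for x
  have "bij_betw p A (f ` A)"
    using assms(4) by (auto simp: p_def bij_betw_def inj_on_def)
  moreover have "bij_betw p (S - A) (S - f ` A)"
    using g by (subst bij_betw_cong[of _ _ g]) (auto simp: p_def)
  ultimately have "bij_betw p (A \<union> (S - A)) (f ` A \<union> (S - f ` A))"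
    by (rule bij_betw_combine) auto
  moreover have "A \<union> (S - A) = S" "f ` A \<union> (S - f ` A) = S" using assms by auto
  ultimately have "p permutes S"
    using assms by (intro bij_imp_permutes) (auto simp: p_def)
  then show thesis by (rule that) (simp add: p_def)
qed

section \<open>Second-moment estimates\<close>

text \<open>The variance of \<open>\<bar>U\<bar>\<close> is nonnegative.\<close>

lemma (in prob_space) expectation_abs_le_sqrt_expectation_power2:
  fixes U :: "'a \<Rightarrow> real"
  assumes [measurable]: "random_variable borel U" and "integrable M (\<lambda>x. (U x)\<^sup>2)"
  shows "expectation (\<lambda>x. \<bar>U x\<bar>) \<le> sqrt (expectation (\<lambda>x. (U x)\<^sup>2))"
proof -
  have sq: "integrable M (\<lambda>x. \<bar>U x\<bar>\<^sup>2)" using assms(2) by simp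
  have int: "integrable M (\<lambda>x. \<bar>U x\<bar>)"
    using square_integrable_imp_integrable[OF _ sq] by auto
  have "(expectation (\<lambda>x. \<bar>U x\<bar>))\<^sup>2 \<le> expectation (\<lambda>x. (U x)\<^sup>2)"
    using variance_eq[OF int sq] variance_positive[of "\<lambda>x. \<bar>U x\<bar>"] by simp
  then show ?thesis by (rule real_le_rsqrt)
qed

text \<open>The variance of the sum is the sum of all covariances. Those outside \<open>R\<close>
  vanish and each of the others is at most \<open>c\<close>, so \<open>R\<close> collects the pairs
  for which no decorrelation is claimed.\<close>

lemma (in prob_space) expectation_sum_deviation_le:
  fixes Z :: "'i \<Rightarrow> 'a \<Rightarrow> real"
  assumes fin: "finite A" and R: "R \<subseteq> A \<times> A"
    and meas: "\<And>a. a \<in> A \<Longrightarrow> random_variable borel (Z a)"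
    and int2: "\<And>a. a \<in> A \<Longrightarrow> integrable M (\<lambda>x. (Z a x)\<^sup>2)"
    and c: "\<And>a. a \<in> A \<Longrightarrow> expectation (\<lambda>x. (Z a x)\<^sup>2) \<le> c"
    and uncorrelated: "\<And>a b. (a, b) \<in> A \<times> A - R \<Longrightarrow>
      expectation (\<lambda>x. Z a x * Z b x) = expectation (Z a) * expectation (Z b)"
  shows "expectation (\<lambda>x. \<bar>(\<Sum>a\<in>A. Z a x) - (\<Sum>a\<in>A. expectation (Z a))\<bar>) \<le> sqrt (c * card R)"
proof -
  define W where "W a x = Z a x - expectation (Z a)" for a x
  have int1: "integrable M (Z a)" if "a \<in> A" for a
    using square_integrable_imp_integrable[OF meas[OF that] int2[OF that]] .
  have prod: "integrable M (\<lambda>x. Z a x * Z b x)" if "a \<in> A" "b \<in> A" for a b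
  proof (rule Bochner_Integration.integrable_bound[OF Bochner_Integration.integrable_add[OF int2[OF that(1)] int2[OF that(2)]]])
    have "norm (u * v) \<le> norm (u\<^sup>2 + v\<^sup>2)" for u v :: real
    proof -
      have "\<bar>u\<bar> * \<bar>v\<bar> \<le> \<bar>u\<bar>\<^sup>2 + \<bar>v\<bar>\<^sup>2"
        using sum_squares_bound[of "\<bar>u\<bar>" "\<bar>v\<bar>"] mult_nonneg_nonneg[OF abs_ge_zero abs_ge_zero, of u v]
        by linarith
      then show ?thesis by (simp add: abs_mult)
    qed
    then show "AE x in M. norm (Z a x * Z b x) \<le> norm ((Z a x)\<^sup>2 + (Z b x)\<^sup>2)"
      by (rule AE_I2)
  qed (use meas that in measurable)
  have WW: "integrable M (\<lambda>x. W a x * W b x)"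
    "expectation (\<lambda>x. W a x * W b x)
      = expectation (\<lambda>x. Z a x * Z b x) - expectation (Z a) * expectation (Z b)"
    if "a \<in> A" "b \<in> A" for a b
    using prod[OF that] int1[OF that(1)] int1[OF that(2)]
    by (simp_all add: W_def algebra_simps prob_space)
  have WW_le: "expectation (\<lambda>x. W a x * W b x) \<le> c" if "a \<in> A" "b \<in> A" for a b
  proof -
    \<comment> \<open>Centering only lowers the second moment: the variance is the second moment
      minus the squared mean.\<close>
    have sq: "expectation (\<lambda>x. W a x * W a x) \<le> c" if "a \<in> A" for a
      using WW(2)[OF that that] c[OF that] by (simp add: power2_eq_square) (smt (verit) zero_le_square)
    have "u * v \<le> (u * u + v * v) / 2" for u v :: real
      using sum_squares_bound[of u v] by (simp add: power2_eq_square)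
    then have "expectation (\<lambda>x. W a x * W b x) \<le> expectation (\<lambda>x. (W a x * W a x + W b x * W b x) / 2)"
      using WW(1) that by (intro integral_mono) auto
    also have "\<dots> = (expectation (\<lambda>x. W a x * W a x) + expectation (\<lambda>x. W b x * W b x)) / 2"
      using WW(1) that by simp
    also have "\<dots> \<le> c" using sq[OF that(1)] sq[OF that(2)] by simp
    finally show ?thesis .
  qed
  let ?U = "\<lambda>x. (\<Sum>a\<in>A. Z a x) - (\<Sum>a\<in>A. expectation (Z a))"
  have U2: "(?U x)\<^sup>2 = (\<Sum>(a, b)\<in>A \<times> A. W a x * W b x)" for x
    by (simp add: W_def sum_subtractf[symmetric] power2_eq_square sum_product sum.cartesian_product)
  have "expectation (\<lambda>x. (?U x)\<^sup>2) = (\<Sum>(a, b)\<in>A \<times> A. expectation (\<lambda>x. W a x * W b x))"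
    unfolding U2 case_prod_beta using WW(1) by (intro Bochner_Integration.integral_sum) auto
  also have "\<dots> = (\<Sum>(a, b)\<in>R. expectation (\<lambda>x. W a x * W b x))"
    using fin R WW(2) uncorrelated by (intro sum.mono_neutral_right) auto
  also have "\<dots> \<le> (\<Sum>(a, b)\<in>R. c)"
    using R WW_le by (intro sum_mono) auto
  finally have le: "expectation (\<lambda>x. (?U x)\<^sup>2) \<le> c * card R" by (simp add: mult.commute)
  have "expectation (\<lambda>x. \<bar>?U x\<bar>) \<le> sqrt (expectation (\<lambda>x. (?U x)\<^sup>2))"
  proof (rule expectation_abs_le_sqrt_expectation_power2)
    show "integrable M (\<lambda>x. (?U x)\<^sup>2)"
      unfolding U2 case_prod_beta using WW(1) by (intro Bochner_Integration.integrable_sum) auto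
  qed (use meas in measurable)
  then show ?thesis using le real_sqrt_le_mono order_trans by blast
qed

section \<open>Integration against a mixture of measures\<close>

text \<open>Tonelli for kernels: the iterated nonnegative integral is finite, so the inner one is
  finite for almost every \<open>w\<close> and agrees there with the Bochner integral.\<close>

lemma has_bochner_integral_bind_nonneg:
  fixes f :: "'b \<Rightarrow> real"
  assumes k: "k \<in> measurable P (subprob_algebra B)"
    and f: "f \<in> borel_measurable B" "\<And>y. 0 \<le> f y" and int: "integrable (P \<bind> k) f"
  shows "AE w in P. integrable (k w) f"
    and "has_bochner_integral P (\<lambda>w. integral\<^sup>L (k w) f) (integral\<^sup>L (P \<bind> k) f)"
proof -
  note [measurable] = k f(1)
  have sets: "f \<in> borel_measurable (k w)" if "w \<in> space P" for w
    using f(1) sets_kernel[OF k that] measurable_cong_sets by blast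
  have nn: "(\<integral>\<^sup>+w. \<integral>\<^sup>+y. f y \<partial>k w \<partial>P) = ennreal (integral\<^sup>L (P \<bind> k) f)"
    using nn_integral_eq_integral[OF int] f by (subst nn_integral_bind[symmetric, where B=B]) auto
  have "AE w in P. (\<integral>\<^sup>+y. f y \<partial>k w) \<noteq> \<infinity>"
    using nn by (intro nn_integral_noteq_infinite) (auto simp: k)
  then show ae: "AE w in P. integrable (k w) f"
  proof (rule AE_mp, intro AE_I2 impI)
    fix w assume "w \<in> space P" "(\<integral>\<^sup>+y. f y \<partial>k w) \<noteq> \<infinity>"
    then show "integrable (k w) f"
      using sets f(2) by (intro integrableI_nonneg) (auto simp: top.not_eq_extremum)
  qed
  have "(\<integral>\<^sup>+w. ennreal (integral\<^sup>L (k w) f) \<partial>P) = (\<integral>\<^sup>+w. \<integral>\<^sup>+y. f y \<partial>k w \<partial>P)"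
    using ae by (intro nn_integral_cong_AE) (auto simp: nn_integral_eq_integral f(2))
  with nn show "has_bochner_integral P (\<lambda>w. integral\<^sup>L (k w) f) (integral\<^sup>L (P \<bind> k) f)"
    by (intro has_bochner_integral_nn_integral) (auto intro!: Bochner_Integration.integral_nonneg f(2))
qed

text \<open>Reduces to the nonnegative case through the positive part \<open>p\<close> and the
  negative part \<open>q\<close>. Where one of them fails to be integrable the identity for
  \<open>f\<close> may break, hence the passage through almost-everywhere equality.\<close>

lemma has_bochner_integral_bind:
  fixes f :: "'b \<Rightarrow> real"
  assumes k: "k \<in> measurable P (subprob_algebra B)"
    and f: "f \<in> borel_measurable B" and int: "integrable (P \<bind> k) f"
  shows "AE w in P. integrable (k w) f"
    and "has_bochner_integral P (\<lambda>w. integral\<^sup>L (k w) f) (integral\<^sup>L (P \<bind> k) f)"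
proof -
  define p q where "p y = max (f y) 0" and "q y = max (- f y) 0" for y
  have pq: "f = (\<lambda>y. p y - q y)" by (auto simp: p_def q_def)
  have int_p: "integrable (P \<bind> k) p" and int_q: "integrable (P \<bind> k) q"
    using int unfolding p_def q_def by auto
  have "p \<in> borel_measurable B" "q \<in> borel_measurable B" using f unfolding p_def q_def by auto
  note p = has_bochner_integral_bind_nonneg[OF k this(1) _ int_p]
    and q = has_bochner_integral_bind_nonneg[OF k this(2) _ int_q]
  have ae: "AE w in P. integrable (k w) p" "AE w in P. integrable (k w) q"
    using p(1) q(1) by (auto simp: p_def q_def)
  then show "AE w in P. integrable (k w) f" unfolding pq by eventually_elim simp
  have "has_bochner_integral P (\<lambda>w. integral\<^sup>L (k w) p - integral\<^sup>L (k w) q)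
      (integral\<^sup>L (P \<bind> k) p - integral\<^sup>L (P \<bind> k) q)"
    using p(2) q(2) by (intro has_bochner_integral_diff) (auto simp: p_def q_def)
  moreover have "integral\<^sup>L (P \<bind> k) p - integral\<^sup>L (P \<bind> k) q = integral\<^sup>L (P \<bind> k) f"
    unfolding pq using int_p int_q by simp
  moreover have "AE w in P. integral\<^sup>L (k w) p - integral\<^sup>L (k w) q = integral\<^sup>L (k w) f"
    using ae unfolding pq by eventually_elim simp
  moreover have "(\<lambda>w. integral\<^sup>L (k w) f) \<in> borel_measurable P"
    using measurable_compose[OF k integral_measurable_subprob_algebra[OF f]] .
  moreover have "(\<lambda>w. integral\<^sup>L (k w) p - integral\<^sup>L (k w) q) \<in> borel_measurable P"
    using calculation(1) by (auto dest: borel_measurable_has_bochner_integral)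
  ultimately show "has_bochner_integral P (\<lambda>w. integral\<^sup>L (k w) f) (integral\<^sup>L (P \<bind> k) f)"
    using has_bochner_integral_cong_AE[of "\<lambda>w. integral\<^sup>L (k w) p - integral\<^sup>L (k w) q" P] by simp
qed

section \<open>Products of two entries sharing their first coordinate\<close>

text \<open>Concatenating two multi-indices with the same first entry \<open>a 1\<close> gives a function \<open>a\<close> on
  \<open>{1..2 * d - 1}\<close>.  The entries \<open>2, \<dots>, d\<close> of the second multi-index sit at \<open>d + 1, \<dots>, 2 * d - 1\<close>.\<close>

definition first_index :: "nat \<Rightarrow> (nat \<Rightarrow> nat) \<Rightarrow> nat \<Rightarrow> nat" where
  "first_index d a = restrict a {1..d}"

definition second_index :: "nat \<Rightarrow> (nat \<Rightarrow> nat) \<Rightarrow> nat \<Rightarrow> nat" where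
  "second_index d a = (\<lambda>r\<in>{1..d}. if r = 1 then a 1 else a (d + r - 1))"

text \<open>The parameter \<open>g\<close> is the identity for the original entries and
  \<open>truncate T\<close> for the truncated ones. The tensor \<open>x\<close> is deterministic, so
  the product can be integrated against a tensor law.\<close>

definition pair_product ::
    "nat \<Rightarrow> (real \<Rightarrow> real) \<Rightarrow> ((nat \<Rightarrow> nat) \<Rightarrow> real) \<Rightarrow> (nat \<Rightarrow> nat) \<Rightarrow> real" where
  "pair_product d g x a = g (x (first_index d a)) * g (x (second_index d a))"

lemma
  assumes "1 \<le> d" "a ` {1..2 * d - 1} \<subseteq> K"
  shows first_index_in_indices: "first_index d a \<in> indices d K"
    and second_index_in_indices: "second_index d a \<in> indices d K"
proof -
  have K: "a r \<in> K" if "1 \<le> r" "r \<le> 2 * d - 1" for r using assms that by auto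
  show "first_index d a \<in> indices d K"
    unfolding first_index_def indices_def by (intro restrict_PiE_iff[THEN iffD2] ballI K) auto
  show "second_index d a \<in> indices d K"
    unfolding second_index_def indices_def by (intro restrict_PiE_iff[THEN iffD2] ballI) (auto intro!: K)
qed

text \<open>Relabelling values commutes with extracting the two indices, so a permutation acts on a
  pair product by acting on \<open>a\<close>.\<close>

lemma compose_first_index: "1 \<le> d \<Longrightarrow> compose {1..d} p (first_index d a) = first_index d (p \<circ> a)"
  by (auto simp: first_index_def compose_def)

lemma compose_second_index: "1 \<le> d \<Longrightarrow> compose {1..d} p (second_index d a) = second_index d (p \<circ> a)"
  by (auto simp: second_index_def compose_def fun_eq_iff)

lemma first_index_cong: "(\<And>r. r \<in> {1..2 * d - 1} \<Longrightarrow> a r = b r) \<Longrightarrow> first_index d a = first_index d b"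
  by (auto simp: first_index_def fun_eq_iff restrict_def)

lemma second_index_cong:
  assumes "\<And>r. r \<in> {1..2 * d - 1} \<Longrightarrow> a r = b r"
  shows "second_index d a = second_index d b"
  unfolding second_index_def by (intro restrict_ext) (auto intro!: assms)

text \<open>The shift \<open>k = 0\<close> gives the two indices in \<open>delta1\<close>, and
  \<open>k = 2 * d - 1\<close> gives the other two in \<open>pc_product\<close>.\<close>

lemma first_index_shift: "1 \<le> d \<Longrightarrow> first_index d (\<lambda>r. k + r) = tup [k + 1..<k + d + 1]"
  by (auto simp: first_index_def tup_def fun_eq_iff restrict_def simp del: upt_Suc)

lemma second_index_shift:
  "1 \<le> d \<Longrightarrow> second_index d (\<lambda>r. k + r) = tup ((k + 1) # [k + d + 1..<k + 2 * d])"
  by (auto simp: second_index_def tup_def fun_eq_iff restrict_def nth_Cons')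

lemma pair_product_eq_tup:
  assumes "1 \<le> d"
  shows "pair_product d g x (\<lambda>r. r) = g (x (tup [1..<d + 1])) * g (x (tup (1 # [d + 1..<2 * d])))"
  using first_index_shift[OF assms, of 0] second_index_shift[OF assms, of 0]
  by (simp add: pair_product_def)

lemma pc_product_eq:
  assumes "1 \<le> d"
  shows "pc_product d X \<omega> = pair_product d (\<lambda>x. x) (\<lambda>i. X i \<omega>) (\<lambda>r. r)
    * pair_product d (\<lambda>x. x) (\<lambda>i. X i \<omega>) (\<lambda>r. 2 * d - 1 + r)"
proof -
  have "2 * d - 1 + 1 = 2 * d" "2 * d - 1 + d + 1 = 3 * d" "2 * d - 1 + 2 * d = 4 * d - 1"
    using assms by auto
  then show ?thesis
    using first_index_shift[OF assms, of "2 * d - 1"] second_index_shift[OF assms, of "2 * d - 1"]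
    unfolding pc_product_def pair_product_eq_tup[OF assms] by (simp add: pair_product_def mult.assoc)
qed

text \<open>The random quantity inside \<open>osc\<close>, as a function of a deterministic tensor,
  so that it can be averaged over the components of a mixture.\<close>

definition mean_square :: "nat \<Rightarrow> nat \<Rightarrow> ((nat \<Rightarrow> nat) \<Rightarrow> real) \<Rightarrow> real" where
  "mean_square n d x = 1 / real n *
     (\<Sum>j=1..n. (1 / real n ^ (d - 1) * (\<Sum>i\<in>{i\<in>indices d {1..n}. i 1 = j}. x i))\<^sup>2)"

lemma osc_eq: "osc M n d X = (LINT \<omega>|M. \<bar>mean_square n d (\<lambda>i. X i \<omega>) - delta1 M d X\<bar>)"
  by (simp add: osc_def mean_square_def)

text \<open>Expanding the square yields pairs of indices with equal first entry \<open>j\<close>.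
  Such a pair has \<open>2 * d - 1\<close> free coordinates and is encoded by one function
  \<open>a\<close>.\<close>

lemma mean_square_eq_sum_pair_product:
  assumes d: "1 \<le> d"
  shows "mean_square n d x = (\<Sum>a\<in>{1..2 * d - 1} \<rightarrow>\<^sub>E {1..n}. pair_product d (\<lambda>x. x) x a) / real n ^ (2 * d - 1)"
proof -
  let ?F = "\<lambda>j. {i\<in>indices d {1..n}. i 1 = j}"
  have fin: "finite (?F j)" for j by (simp add: indices_def finite_PiE)
  have "(\<Sum>j=1..n. (\<Sum>i\<in>?F j. x i)\<^sup>2) = (\<Sum>j=1..n. \<Sum>(i, i')\<in>?F j \<times> ?F j. x i * x i')"
    by (simp add: power2_eq_square sum_product sum.cartesian_product)
  also have "\<dots> = (\<Sum>(j, i, i')\<in>(SIGMA j:{1..n}. ?F j \<times> ?F j). x i * x i')"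
    using fin by (subst sum.Sigma) (auto simp: case_prod_beta)
  also have "\<dots> = (\<Sum>a\<in>{1..2 * d - 1} \<rightarrow>\<^sub>E {1..n}. pair_product d (\<lambda>x. x) x a)"
  \<comment> \<open>A position \<open>r\<close> beyond \<open>d\<close> holds entry
    \<open>r - d + 1\<close> of the second index, which inverts the position
    \<open>d + r - 1\<close> in \<open>second_index\<close>.\<close>
  proof (rule sum.reindex_bij_witness[where
      j = "\<lambda>(j, i, i'). \<lambda>r\<in>{1..2 * d - 1}. if r \<le> d then i r else i' (r - d + 1)" and
      i = "\<lambda>a. (a 1, first_index d a, second_index d a)"])
    fix a assume a: "a \<in> {1..2 * d - 1} \<rightarrow>\<^sub>E {1..n}"
    then have sub: "a ` {1..2 * d - 1} \<subseteq> {1..n}" by auto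
    show "(a 1, first_index d a, second_index d a) \<in> (SIGMA j:{1..n}. ?F j \<times> ?F j)"
      using first_index_in_indices[OF d sub] second_index_in_indices[OF d sub] a d
      by (auto simp: first_index_def second_index_def)
    show "(case (a 1, first_index d a, second_index d a) of (j, i, i') \<Rightarrow>
        \<lambda>r\<in>{1..2 * d - 1}. if r \<le> d then i r else i' (r - d + 1)) = a"
      using a d by (auto simp: first_index_def second_index_def fun_eq_iff PiE_iff extensional_def)
  next
    fix t assume "t \<in> (SIGMA j:{1..n}. ?F j \<times> ?F j)"
    then obtain j i i' where t: "t = (j, i, i')" "i \<in> indices d {1..n}" "i' \<in> indices d {1..n}"
      "i 1 = j" "i' 1 = j" by auto
    let ?a = "\<lambda>r\<in>{1..2 * d - 1}. if r \<le> d then i r else i' (r - d + 1)"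
    have i: "first_index d ?a = i" "second_index d ?a = i'" "?a 1 = j"
      using t d by (auto simp: first_index_def second_index_def indices_def fun_eq_iff PiE_iff extensional_def)
    show "(\<lambda>a. (a 1, first_index d a, second_index d a))
       (case t of (j, i, i') \<Rightarrow> \<lambda>r\<in>{1..2 * d - 1}. if r \<le> d then i r else i' (r - d + 1)) = t"
      using i t by simp
    show "(case t of (j, i, i') \<Rightarrow> \<lambda>r\<in>{1..2 * d - 1}. if r \<le> d then i r else i' (r - d + 1))
      \<in> {1..2 * d - 1} \<rightarrow>\<^sub>E {1..n}"
      using t d by (auto simp: indices_def PiE_iff)
    show "pair_product d (\<lambda>x. x) x
        (case t of (j, i, i') \<Rightarrow> \<lambda>r\<in>{1..2 * d - 1}. if r \<le> d then i r else i' (r - d + 1))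
      = (case t of (j, i, i') \<Rightarrow> x i * x i')"
      using i t by (simp add: pair_product_def)
  qed
  finally have eq: "(\<Sum>j=1..n. (\<Sum>i\<in>?F j. x i)\<^sup>2)
    = (\<Sum>a\<in>{1..2 * d - 1} \<rightarrow>\<^sub>E {1..n}. pair_product d (\<lambda>x. x) x a)" .
  \<comment> \<open>The outer average and the squared inner normalisation together divide by the
    number of functions \<open>a\<close>.\<close>
  have "real n * (real n ^ (d - 1))\<^sup>2 = real n ^ Suc (2 * (d - 1))"
    by (simp add: power_mult[symmetric] mult.commute)
  also have "Suc (2 * (d - 1)) = 2 * d - 1" using d by simp
  finally have pow: "real n * (real n ^ (d - 1))\<^sup>2 = real n ^ (2 * d - 1)" .
  show ?thesis
    unfolding mean_square_def pow[symmetric] eq[symmetric]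
    by (simp add: power_mult_distrib power_divide sum_divide_distrib[symmetric])
qed

section \<open>Truncation and cubic bounds\<close>

text \<open>Large values are sent to 0 rather than clipped at \<open>T\<close>, so a product of
  truncations vanishes as soon as one factor is large.\<close>

definition truncate :: "real \<Rightarrow> real \<Rightarrow> real" where
  "truncate T x = (if \<bar>x\<bar> \<le> T then x else 0)"

lemma abs_truncate_le: "\<bar>truncate T x\<bar> \<le> \<bar>x\<bar>"
  and abs_truncate_le_bound: "0 \<le> T \<Longrightarrow> \<bar>truncate T x\<bar> \<le> T"
  by (auto simp: truncate_def)

lemma measurable_truncate [measurable]: "truncate T \<in> borel_measurable borel"
  unfolding truncate_def[abs_def] by measurable

text \<open>The error is nonzero only if one factor exceeds \<open>T\<close>. Replacing
  \<open>T\<close> by that factor bounds \<open>T * \<bar>x * y\<bar>\<close> by the cube of the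
  larger of the two absolute values.\<close>

lemma abs_mult_truncation_error_le:
  assumes "0 < T"
  shows "\<bar>x * y - truncate T x * truncate T y\<bar> \<le> (\<bar>x\<bar> ^ 3 + \<bar>y\<bar> ^ 3) / T"
proof (cases "\<bar>x\<bar> \<le> T \<and> \<bar>y\<bar> \<le> T")
  case True
  then show ?thesis using assms by (simp add: truncate_def)
next
  case False
  have large: "T * (u * v) \<le> u ^ 3 + v ^ 3" if "T < u" "0 \<le> v" for u v :: real
  proof -
    have "T * (u * v) \<le> u * (u * v)" using that assms by (intro mult_right_mono) auto
    also have "\<dots> \<le> u ^ 3 + v ^ 3"
    proof (cases "v \<le> u")
      case True
      then have "u * (u * v) \<le> u * (u * u)" using that assms by (intro mult_left_mono) auto
      then show ?thesis using that by (simp add: power3_eq_cube mult.assoc add_increasing2)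
    next
      case False
      then have "u * (u * v) \<le> v * (v * v)" using that assms by (intro mult_mono) auto
      then show ?thesis using that assms by (simp add: power3_eq_cube mult.assoc add_increasing)
    qed
    finally show ?thesis .
  qed
  have "T * \<bar>x * y\<bar> \<le> \<bar>x\<bar> ^ 3 + \<bar>y\<bar> ^ 3"
    using False large[of "\<bar>x\<bar>" "\<bar>y\<bar>"] large[of "\<bar>y\<bar>" "\<bar>x\<bar>"]
    by (auto simp: abs_mult mult.commute add.commute)
  moreover have "truncate T x * truncate T y = 0" using False by (auto simp: truncate_def)
  ultimately show ?thesis using assms by (simp only: pos_le_divide_eq mult.commute[of _ T] diff_0_right)
qed

text \<open>From \<open>2uv \<le> u^2 + v^2\<close> and \<open>u^2 \<le> u^3 + 1\<close> for
  nonnegative \<open>u\<close>. This makes products of two entries integrable and is the source of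
  the summand 1 added to the third moment.\<close>

lemma abs_mult_le_cubes: "\<bar>x * y\<bar> \<le> (\<bar>x\<bar> ^ 3 + \<bar>y\<bar> ^ 3) / 2 + (1::real)"
proof -
  have *: "\<bar>u\<bar>\<^sup>2 \<le> \<bar>u\<bar> ^ 3 + 1" for u :: real
  proof (cases "\<bar>u\<bar> \<le> 1")
    case True
    then show ?thesis using power_le_one[of "\<bar>u\<bar>" 2] by (simp add: add_increasing)
  next
    case False
    then show ?thesis using power_increasing[of 2 3 "\<bar>u\<bar>"] by simp
  qed
  have "2 * \<bar>x * y\<bar> \<le> \<bar>x\<bar>\<^sup>2 + \<bar>y\<bar>\<^sup>2" using sum_squares_bound[of "\<bar>x\<bar>" "\<bar>y\<bar>"] by (simp add: abs_mult)
  then show ?thesis using *[of x] *[of y] by (simp only: add_divide_distrib)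
qed

text \<open>A truncated fourth power costs one factor \<open>T\<close> and a third power. Second
  moments of truncated products thus grow only linearly in \<open>T\<close>, using third moments
  alone.\<close>

lemma truncated_product_power2_le:
  assumes "0 < T"
  shows "(truncate T x * truncate T y)\<^sup>2 \<le> T * ((\<bar>x\<bar> ^ 3 + \<bar>y\<bar> ^ 3) / 2)"
proof -
  have *: "((truncate T u)\<^sup>2)\<^sup>2 \<le> T * \<bar>u\<bar> ^ 3" for u
  proof -
    have "((truncate T u)\<^sup>2)\<^sup>2 = \<bar>truncate T u\<bar> * \<bar>truncate T u\<bar> ^ 3"
      by (simp flip: power_Suc power_mult)
    also have "\<dots> \<le> T * \<bar>u\<bar> ^ 3"
      using assms by (intro mult_mono power_mono abs_truncate_le abs_truncate_le_bound) auto
    finally show ?thesis .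
  qed
  have "(truncate T x * truncate T y)\<^sup>2 \<le> (((truncate T x)\<^sup>2)\<^sup>2 + ((truncate T y)\<^sup>2)\<^sup>2) / 2"
    using sum_squares_bound[of "(truncate T x)\<^sup>2" "(truncate T y)\<^sup>2"] by (simp add: power_mult_distrib)
  also have "\<dots> \<le> T * ((\<bar>x\<bar> ^ 3 + \<bar>y\<bar> ^ 3) / 2)"
    using *[of x] *[of y] by (simp add: algebra_simps)
  finally show ?thesis .
qed

section \<open>Measurability of functions of tensors\<close>

lemma measurable_coordinate_tensor_space [measurable (raw)]:
  "i \<in> indices d K \<Longrightarrow> (\<lambda>y. y i) \<in> borel_measurable (tensor_space d K)"
  unfolding tensor_space_def by (rule measurable_component_singleton)

lemma measurable_pair_product_tensor_space:
  assumes "1 \<le> d" "a ` {1..2 * d - 1} \<subseteq> K" and [measurable]: "g \<in> borel_measurable borel"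
  shows "(\<lambda>y. pair_product d g y a) \<in> borel_measurable (tensor_space d K)"
  unfolding pair_product_def
  using first_index_in_indices[OF assms(1,2)] second_index_in_indices[OF assms(1,2)] by measurable

lemma subtensor_apply [simp]: "i \<in> indices d K \<Longrightarrow> subtensor d K X \<omega> i = X i \<omega>"
  by (simp add: subtensor_def)

lemma measurable_subtensor:
  assumes "\<And>i. i \<in> indices d K \<Longrightarrow> X i \<in> borel_measurable M"
  shows "subtensor d K X \<in> measurable M (tensor_space d K)"
  unfolding subtensor_def[abs_def] tensor_space_def using assms by (intro measurable_restrict) auto

lemma pair_product_subtensor:
  assumes "1 \<le> d" "a ` {1..2 * d - 1} \<subseteq> K"
  shows "pair_product d g (subtensor d K X \<omega>) a = pair_product d g (\<lambda>i. X i \<omega>) a"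
  using first_index_in_indices[OF assms] second_index_in_indices[OF assms]
  by (simp add: pair_product_def)

lemma compose_permutation_in_indices:
  "\<pi> permutes K \<Longrightarrow> i \<in> indices d K \<Longrightarrow> compose {1..d} \<pi> i \<in> indices d K"
  by (auto simp: indices_def compose_def PiE_iff permutes_in_image)

section \<open>Moments of exchangeable tensors\<close>

text \<open>Gathers what the mixture shares with almost every one of its components, so that the
  locale can be interpreted at both. Dissociation is assumed separately where it is needed.\<close>

locale exchangeable_tensor = prob_space M for M :: "'a measure" +
  fixes n d :: nat and X :: "(nat \<Rightarrow> nat) \<Rightarrow> 'a \<Rightarrow> real"
  assumes d_pos: "1 \<le> d" and n_ge: "4 * d \<le> n"
    and measurable_entry [measurable (raw)]: "i \<in> indices d {1..n} \<Longrightarrow> X i \<in> borel_measurable M"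
    and exch: "exchangeable M n d X"
    and diag: "diagonal_vanish M n d X"
    and integrable_cube: "i \<in> indices d {1..n} \<Longrightarrow> integrable M (\<lambda>\<omega>. \<bar>X i \<omega>\<bar> ^ 3)"
begin

definition third_moment :: real where
  "third_moment = expectation (\<lambda>\<omega>. \<bar>X (tup [1..<d + 1]) \<omega>\<bar> ^ 3)"

lemma third_moment_nonneg: "0 \<le> third_moment"
  unfolding third_moment_def by (intro Bochner_Integration.integral_nonneg) auto

lemma expectation_exchange:
  fixes f :: "((nat \<Rightarrow> nat) \<Rightarrow> real) \<Rightarrow> real"
  assumes "\<pi> permutes {1..n}" and f: "f \<in> borel_measurable (tensor_space d {1..n})"
  shows "expectation (\<lambda>\<omega>. f (subtensor d {1..n} X \<omega>))
    = expectation (\<lambda>\<omega>. f (subtensor d {1..n} (\<lambda>i. X (compose {1..d} \<pi> i)) \<omega>))"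
proof -
  have "integral\<^sup>L (tensor_law M n d X) f
      = integral\<^sup>L (tensor_law M n d (\<lambda>i. X (compose {1..d} \<pi> i))) f"
    using exch assms(1) unfolding exchangeable_def by metis
  moreover have "subtensor d {1..n} X \<in> measurable M (tensor_space d {1..n})"
    by (intro measurable_subtensor measurable_entry)
  moreover have "subtensor d {1..n} (\<lambda>i. X (compose {1..d} \<pi> i)) \<in> measurable M (tensor_space d {1..n})"
    by (intro measurable_subtensor measurable_entry compose_permutation_in_indices[OF assms(1)])
  ultimately show ?thesis
    unfolding tensor_law_def using f by (simp add: integral_distr)
qed

lemma expectation_cube_inj:
  assumes i: "i \<in> indices d {1..n}" and inj: "inj_on i {1..d}"
  shows "expectation (\<lambda>\<omega>. \<bar>X i \<omega>\<bar> ^ 3) = third_moment"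
proof -
  obtain \<pi> where \<pi>: "\<pi> permutes {1..n}" "\<And>r. r \<in> {1..d} \<Longrightarrow> \<pi> r = i r"
    using inj_on_extends_to_permutation[of "{1..n}" "{1..d}" i] inj i n_ge
    by (auto simp: indices_def)
  let ?i = "tup [1..<d + 1]"
  have t: "?i = restrict (\<lambda>r. r) {1..d}"
    using first_index_shift[OF d_pos, of 0] by (simp add: first_index_def)
  then have mem: "?i \<in> indices d {1..n}" using n_ge by (auto simp: indices_def)
  have "compose {1..d} \<pi> ?i = i"
    unfolding t using i \<pi>(2) by (auto simp: compose_def indices_def fun_eq_iff PiE_iff extensional_def)
  moreover have "(\<lambda>y. \<bar>y ?i\<bar> ^ 3) \<in> borel_measurable (tensor_space d {1..n})"
    using mem by measurable
  ultimately show ?thesis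
    using expectation_exchange[OF \<pi>(1), of "\<lambda>y. \<bar>y ?i\<bar> ^ 3"] mem by (simp add: third_moment_def)
qed

text \<open>Exchangeability handles injective indices; at the others the entry vanishes almost
  surely.\<close>

lemma expectation_cube_le:
  assumes i: "i \<in> indices d {1..n}"
  shows "expectation (\<lambda>\<omega>. \<bar>X i \<omega>\<bar> ^ 3) \<le> third_moment"
proof (cases "inj_on i {1..d}")
  case True
  then show ?thesis using expectation_cube_inj[OF i] by simp
next
  case False
  then have "AE \<omega> in M. X i \<omega> = 0" using diag i by (auto simp: diagonal_vanish_def)
  then have "AE \<omega> in M. \<bar>X i \<omega>\<bar> ^ 3 = 0" by auto
  then show ?thesis using integral_eq_zero_AE third_moment_nonneg by fastforce
qed

text \<open>A permutation extending \<open>a\<close> carries the reference indices of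
  \<open>delta1\<close> to those of \<open>a\<close>. Injectivity on all \<open>2 * d - 1\<close>
  positions is what allows the extension.\<close>

lemma expectation_pair_product_inj:
  assumes [measurable]: "g \<in> borel_measurable borel"
    and a: "a ` {1..2 * d - 1} \<subseteq> {1..n}" "inj_on a {1..2 * d - 1}"
  shows "expectation (\<lambda>\<omega>. pair_product d g (\<lambda>i. X i \<omega>) a)
    = expectation (\<lambda>\<omega>. pair_product d g (\<lambda>i. X i \<omega>) (\<lambda>r. r))"
proof -
  obtain \<pi> where \<pi>: "\<pi> permutes {1..n}" "\<And>r. r \<in> {1..2 * d - 1} \<Longrightarrow> \<pi> r = a r"
  proof (rule inj_on_extends_to_permutation[of "{1..n}" "{1..2 * d - 1}" a])
    show "{1..2 * d - 1} \<subseteq> {1..n}" using n_ge by auto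
  qed (use a in auto)
  have sub: "(\<lambda>r. r) ` {1..2 * d - 1} \<subseteq> {1..n}" using n_ge by auto
  have "first_index d (\<pi> \<circ> (\<lambda>r. r)) = first_index d a" "second_index d (\<pi> \<circ> (\<lambda>r. r)) = second_index d a"
    using \<pi>(2) by (auto intro!: first_index_cong second_index_cong)
  then have "pair_product d g (\<lambda>i. X (compose {1..d} \<pi> i) \<omega>) (\<lambda>r. r) = pair_product d g (\<lambda>i. X i \<omega>) a" for \<omega>
    by (simp only: pair_product_def compose_first_index[OF d_pos] compose_second_index[OF d_pos])
  then show ?thesis
    using expectation_exchange[OF \<pi>(1) measurable_pair_product_tensor_space[OF d_pos sub assms(1)]]
    by (simp only: pair_product_subtensor[OF d_pos sub])
qed

lemma measurable_pair_product:
  assumes [measurable]: "g \<in> borel_measurable borel" and a: "a ` {1..2 * d - 1} \<subseteq> {1..n}"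
  shows "(\<lambda>\<omega>. pair_product d g (\<lambda>i. X i \<omega>) a) \<in> borel_measurable M"
  unfolding pair_product_def
  using measurable_entry[OF first_index_in_indices[OF d_pos a]]
    measurable_entry[OF second_index_in_indices[OF d_pos a]] by measurable

lemma
  assumes g: "g \<in> borel_measurable borel" "\<And>x. \<bar>g x\<bar> \<le> \<bar>x\<bar>" and a: "a ` {1..2 * d - 1} \<subseteq> {1..n}"
  shows integrable_pair_product: "integrable M (\<lambda>\<omega>. pair_product d g (\<lambda>i. X i \<omega>) a)"
    and abs_expectation_pair_product_le:
      "\<bar>expectation (\<lambda>\<omega>. pair_product d g (\<lambda>i. X i \<omega>) a)\<bar> \<le> third_moment + 1"
proof -
  let ?i = "first_index d a" and ?j = "second_index d a"
  let ?h = "\<lambda>\<omega>. (\<bar>X ?i \<omega>\<bar> ^ 3 + \<bar>X ?j \<omega>\<bar> ^ 3) / 2 + 1"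
  note mem = first_index_in_indices[OF d_pos a] second_index_in_indices[OF d_pos a]
  have int: "integrable M ?h" using integrable_cube mem by auto
  have bound: "\<bar>pair_product d g (\<lambda>i. X i \<omega>) a\<bar> \<le> ?h \<omega>" for \<omega>
  proof -
    have "\<bar>pair_product d g (\<lambda>i. X i \<omega>) a\<bar> \<le> \<bar>X ?i \<omega> * X ?j \<omega>\<bar>"
      unfolding pair_product_def abs_mult by (intro mult_mono g) auto
    also have "\<dots> \<le> ?h \<omega>" by (rule abs_mult_le_cubes)
    finally show ?thesis .
  qed
  show int_p: "integrable M (\<lambda>\<omega>. pair_product d g (\<lambda>i. X i \<omega>) a)"
  proof (rule Bochner_Integration.integrable_bound[OF int measurable_pair_product[OF g(1) a]])
    show "AE \<omega> in M. norm (pair_product d g (\<lambda>i. X i \<omega>) a) \<le> norm (?h \<omega>)"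
      unfolding real_norm_def using bound by (intro AE_I2) (rule order_trans[OF _ abs_ge_self])
  qed
  have "\<bar>expectation (\<lambda>\<omega>. pair_product d g (\<lambda>i. X i \<omega>) a)\<bar>
      \<le> expectation (\<lambda>\<omega>. \<bar>pair_product d g (\<lambda>i. X i \<omega>) a\<bar>)"
    by (rule integral_abs_bound)
  also have "\<dots> \<le> expectation ?h"
    using int_p int bound by (intro integral_mono) auto
  also have "\<dots> \<le> third_moment + 1"
    using integrable_cube mem expectation_cube_le[OF mem(1)] expectation_cube_le[OF mem(2)]
    by (simp add: prob_space)
  finally show "\<bar>expectation (\<lambda>\<omega>. pair_product d g (\<lambda>i. X i \<omega>) a)\<bar> \<le> third_moment + 1" .
qed

lemma expectation_pair_product_truncation_error_le:
  assumes T: "0 < T" and a: "a ` {1..2 * d - 1} \<subseteq> {1..n}"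
  shows "expectation (\<lambda>\<omega>. \<bar>pair_product d (\<lambda>x. x) (\<lambda>i. X i \<omega>) a - pair_product d (truncate T) (\<lambda>i. X i \<omega>) a\<bar>)
    \<le> 2 * third_moment / T"
proof -
  let ?i = "first_index d a" and ?j = "second_index d a"
  note mem = first_index_in_indices[OF d_pos a] second_index_in_indices[OF d_pos a]
  have "expectation (\<lambda>\<omega>. \<bar>pair_product d (\<lambda>x. x) (\<lambda>i. X i \<omega>) a - pair_product d (truncate T) (\<lambda>i. X i \<omega>) a\<bar>)
    \<le> expectation (\<lambda>\<omega>. (\<bar>X ?i \<omega>\<bar> ^ 3 + \<bar>X ?j \<omega>\<bar> ^ 3) / T)"
  proof (rule integral_mono)
    show "integrable M (\<lambda>\<omega>. \<bar>pair_product d (\<lambda>x. x) (\<lambda>i. X i \<omega>) a - pair_product d (truncate T) (\<lambda>i. X i \<omega>) a\<bar>)"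
      by (intro integrable_abs Bochner_Integration.integrable_diff integrable_pair_product a)
        (auto simp: abs_truncate_le)
    show "integrable M (\<lambda>\<omega>. (\<bar>X ?i \<omega>\<bar> ^ 3 + \<bar>X ?j \<omega>\<bar> ^ 3) / T)"
      using integrable_cube mem by auto
  qed (simp add: pair_product_def abs_mult_truncation_error_le T)
  also have "\<dots> \<le> 2 * third_moment / T"
    using integrable_cube mem expectation_cube_le[OF mem(1)] expectation_cube_le[OF mem(2)] T
    by (simp add: divide_right_mono)
  finally show ?thesis .
qed

lemma
  assumes T: "0 < T" and a: "a ` {1..2 * d - 1} \<subseteq> {1..n}"
  shows integrable_truncated_pair_product_power2:
      "integrable M (\<lambda>\<omega>. (pair_product d (truncate T) (\<lambda>i. X i \<omega>) a)\<^sup>2)"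
    and expectation_truncated_pair_product_power2_le:
      "expectation (\<lambda>\<omega>. (pair_product d (truncate T) (\<lambda>i. X i \<omega>) a)\<^sup>2) \<le> T * third_moment"
proof -
  let ?i = "first_index d a" and ?j = "second_index d a"
  let ?h = "\<lambda>\<omega>. T * ((\<bar>X ?i \<omega>\<bar> ^ 3 + \<bar>X ?j \<omega>\<bar> ^ 3) / 2)"
  note mem = first_index_in_indices[OF d_pos a] second_index_in_indices[OF d_pos a]
  have int: "integrable M ?h" using integrable_cube mem by auto
  have bound: "(pair_product d (truncate T) (\<lambda>i. X i \<omega>) a)\<^sup>2 \<le> ?h \<omega>" for \<omega>
    unfolding pair_product_def by (rule truncated_product_power2_le[OF T])
  note [measurable] = measurable_pair_product[OF measurable_truncate a]
  show int2: "integrable M (\<lambda>\<omega>. (pair_product d (truncate T) (\<lambda>i. X i \<omega>) a)\<^sup>2)"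
  proof (rule Bochner_Integration.integrable_bound[OF int])
    show "AE \<omega> in M. norm ((pair_product d (truncate T) (\<lambda>i. X i \<omega>) a)\<^sup>2) \<le> norm (?h \<omega>)"
      unfolding real_norm_def abs_power2 using bound by (intro AE_I2) (rule order_trans[OF _ abs_ge_self])
  qed measurable
  have "expectation (\<lambda>\<omega>. (pair_product d (truncate T) (\<lambda>i. X i \<omega>) a)\<^sup>2) \<le> expectation ?h"
    using int2 int bound by (intro integral_mono) auto
  also have "\<dots> \<le> T * third_moment"
    using integrable_cube mem expectation_cube_le[OF mem(1)] expectation_cube_le[OF mem(2)] T
    by simp
  finally show "expectation (\<lambda>\<omega>. (pair_product d (truncate T) (\<lambda>i. X i \<omega>) a)\<^sup>2) \<le> T * third_moment" .
qed

lemma delta1_eq: "delta1 M d X = expectation (\<lambda>\<omega>. pair_product d (\<lambda>x. x) (\<lambda>i. X i \<omega>) (\<lambda>r. r))"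
  by (simp add: delta1_def pair_product_eq_tup[OF d_pos])

text \<open>The two products depend on subtensors over disjoint sets of labels, which dissociation
  makes independent.\<close>

lemma expectation_pair_product_mult:
  assumes diss: "dissociated M n d X"
    and g: "g \<in> borel_measurable borel" "\<And>x. \<bar>g x\<bar> \<le> \<bar>x\<bar>"
    and a: "a ` {1..2 * d - 1} \<subseteq> {1..n}" and b: "b ` {1..2 * d - 1} \<subseteq> {1..n}"
    and disjoint: "a ` {1..2 * d - 1} \<inter> b ` {1..2 * d - 1} = {}"
  shows "expectation (\<lambda>\<omega>. pair_product d g (\<lambda>i. X i \<omega>) a * pair_product d g (\<lambda>i. X i \<omega>) b)
    = expectation (\<lambda>\<omega>. pair_product d g (\<lambda>i. X i \<omega>) a) * expectation (\<lambda>\<omega>. pair_product d g (\<lambda>i. X i \<omega>) b)"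
proof -
  have card: "card (a ` {1..2 * d - 1}) \<le> 2 * d" "card (b ` {1..2 * d - 1}) \<le> 2 * d"
    using card_image_le[of "{1..2 * d - 1}" a] card_image_le[of "{1..2 * d - 1}" b] by auto
  \<comment> \<open>Dissociation speaks only of sets with at least \<open>d\<close> elements, while
    a non-injective \<open>a\<close> may take fewer values. The image of \<open>a\<close> is padded
    to \<open>K\<close> with \<open>2 * d\<close> elements avoiding the image of \<open>b\<close>;
    its complement \<open>L\<close> keeps at least \<open>d\<close> since
    \<open>n \<ge> 4 * d\<close>.\<close>
  have "2 * d \<le> card ({1..n} - b ` {1..2 * d - 1})"
    using card n_ge b by (subst card_Diff_subset) auto
  then obtain K where K: "a ` {1..2 * d - 1} \<subseteq> K" "K \<subseteq> {1..n} - b ` {1..2 * d - 1}" "card K = 2 * d"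
  proof (elim exists_subset_between[THEN exE, rotated])
    show "a ` {1..2 * d - 1} \<subseteq> {1..n} - b ` {1..2 * d - 1}" using a disjoint by blast
  qed (use card in auto)
  define L where "L = {1..n} - K"
  have K_sub: "K \<subseteq> {1..n}" using K(2) by blast
  then have "card L = n - 2 * d"
    using K(3) finite_subset[of K "{1..n}"] unfolding L_def by (subst card_Diff_subset) auto
  then have L: "b ` {1..2 * d - 1} \<subseteq> L" "L \<subseteq> {1..n}" "K \<inter> L = {}" "d \<le> card L"
    using K b n_ge by (auto simp: L_def)
  have "indep_var (tensor_space d K) (subtensor d K X) (tensor_space d L) (subtensor d L X)"
    using diss[unfolded dissociated_def, rule_format, of K L] K_sub K(3) L by simp
  then have "indep_var borel ((\<lambda>y. pair_product d g y a) \<circ> subtensor d K X)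
      borel ((\<lambda>y. pair_product d g y b) \<circ> subtensor d L X)"
    by (rule indep_var_compose) (intro measurable_pair_product_tensor_space d_pos K L g)+
  then have "indep_var borel (\<lambda>\<omega>. pair_product d g (\<lambda>i. X i \<omega>) a) borel (\<lambda>\<omega>. pair_product d g (\<lambda>i. X i \<omega>) b)"
    by (simp add: comp_def pair_product_subtensor[OF d_pos K(1)] pair_product_subtensor[OF d_pos L(1)])
  then show ?thesis
    by (rule indep_var_lebesgue_integral) (intro integrable_pair_product g a b)+
qed

text \<open>The two pairs in \<open>pc_product\<close> use the disjoint labels
  \<open>1, ..., 2 * d - 1\<close> and \<open>2 * d, ..., 4 * d - 2\<close>, so the expectation
  factors into two copies of \<open>delta1\<close>.\<close>

lemma expectation_pc_product:
  assumes "dissociated M n d X"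
  shows "expectation (pc_product d X) = (delta1 M d X)\<^sup>2"
proof -
  let ?b = "\<lambda>r. 2 * d - 1 + r"
  have a: "(\<lambda>r. r) ` {1..2 * d - 1} \<subseteq> {1..n}" and b: "?b ` {1..2 * d - 1} \<subseteq> {1..n}"
    and disjoint: "(\<lambda>r. r) ` {1..2 * d - 1} \<inter> ?b ` {1..2 * d - 1} = {}"
    using n_ge by auto
  have "expectation (\<lambda>\<omega>. pair_product d (\<lambda>x. x) (\<lambda>i. X i \<omega>) ?b) = delta1 M d X"
    unfolding delta1_eq using b by (intro expectation_pair_product_inj) (auto simp: inj_on_def)
  then show ?thesis
    using expectation_pair_product_mult[OF assms _ _ a b disjoint, of "\<lambda>x. x"]
    by (simp add: pc_product_eq[OF d_pos, abs_def] delta1_eq power2_eq_square)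
qed

lemma integrable_mean_square: "integrable M (\<lambda>\<omega>. mean_square n d (\<lambda>i. X i \<omega>))"
  unfolding mean_square_eq_sum_pair_product[OF d_pos]
  by (intro integrable_divide Bochner_Integration.integrable_sum integrable_pair_product) auto

text \<open>Triangle inequality for a change of centre: the components of a mixture are compared
  with \<open>delta1\<close> of the mixture, not with their own.\<close>

lemma expectation_abs_mean_square_diff_le:
  "expectation (\<lambda>\<omega>. \<bar>mean_square n d (\<lambda>i. X i \<omega>) - c\<bar>) \<le> osc M n d X + \<bar>delta1 M d X - c\<bar>"
proof -
  have "expectation (\<lambda>\<omega>. \<bar>mean_square n d (\<lambda>i. X i \<omega>) - c\<bar>)
    \<le> expectation (\<lambda>\<omega>. \<bar>mean_square n d (\<lambda>i. X i \<omega>) - delta1 M d X\<bar> + \<bar>delta1 M d X - c\<bar>)"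
    using integrable_mean_square by (intro integral_mono) auto
  also have "\<dots> = osc M n d X + \<bar>delta1 M d X - c\<bar>"
    using integrable_mean_square by (simp add: osc_eq prob_space)
  finally show ?thesis .
qed

section \<open>The dissociated case\<close>

text \<open>At truncation level \<open>T\<close>, the square root of \<open>n\<close>, truncation
  and non-injective indices contribute terms of order \<open>1 / T\<close>. The fluctuation of the
  truncated sum contributes \<open>1 / q\<close>, the stated rate.\<close>

lemma osc_le_of_dissociated:
  assumes diss: "dissociated M n d X"
  shows "osc M n d X \<le> 16 * real d * (third_moment + 1) / root 4 (real n)"
proof -
  define m where "m = 2 * d - 1"
  define A where "A = {1..m} \<rightarrow>\<^sub>E {1..n}"
  define V where "V = real n ^ m"
  define q where "q = root 4 (real n)"
  define T where "T = q\<^sup>2"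
  define B where "B = third_moment"
  define Z where "Z a \<omega> = pair_product d (\<lambda>x. x) (\<lambda>i. X i \<omega>) a" for a \<omega>
  define Z' where "Z' a \<omega> = pair_product d (truncate T) (\<lambda>i. X i \<omega>) a" for a \<omega>
  define \<delta> where "\<delta> = delta1 M d X"
  define \<delta>' where "\<delta>' = expectation (Z' (\<lambda>r. r))"
  have n_pos: "1 \<le> n" and m_pos: "1 \<le> m" using d_pos n_ge by (auto simp: m_def)
  have q: "1 \<le> q" "q ^ 4 = real n" using n_pos by (auto simp: q_def real_root_pow_pos2)
  have n_eq: "real n = T\<^sup>2" using q(2) by (simp add: T_def flip: power_mult)
  have T_pos: "0 < T" using q by (simp add: T_def)
  have V_pos: "0 < V" using n_pos by (simp add: V_def)
  have B: "0 \<le> B" using third_moment_nonneg by (simp add: B_def)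
  have finA: "finite A" by (simp add: A_def finite_PiE)
  have cardA: "real (card A) = V" by (simp add: A_def V_def card_funcsetE)
  have V_eq: "V = real n * real n ^ (m - 1)" using m_pos by (simp add: V_def power_eq_if)
  have sub: "a ` {1..2 * d - 1} \<subseteq> {1..n}" if "a \<in> A" for a using that by (auto simp: A_def m_def)
  have sub0: "(\<lambda>r. r) ` {1..2 * d - 1} \<subseteq> {1..n}" using n_ge by auto
  have intZ: "integrable M (Z a)" if "a ` {1..2 * d - 1} \<subseteq> {1..n}" for a
    unfolding Z_def using that by (intro integrable_pair_product) auto
  have intZ': "integrable M (Z' a)" if "a ` {1..2 * d - 1} \<subseteq> {1..n}" for a
    unfolding Z'_def using that by (intro integrable_pair_product abs_truncate_le) auto

  have trunc: "expectation (\<lambda>\<omega>. \<bar>Z a \<omega> - Z' a \<omega>\<bar>) \<le> 2 * B / T" if "a ` {1..2 * d - 1} \<subseteq> {1..n}" for a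
    unfolding Z_def Z'_def B_def by (rule expectation_pair_product_truncation_error_le[OF T_pos that])
  \<comment> \<open>Truncation also moves the centre, by no more than the error for one
    product.\<close>
  have \<delta>_diff: "\<bar>\<delta>' - \<delta>\<bar> \<le> 2 * B / T"
  proof -
    have "\<bar>\<delta>' - \<delta>\<bar> = \<bar>expectation (\<lambda>\<omega>. Z (\<lambda>r. r) \<omega> - Z' (\<lambda>r. r) \<omega>)\<bar>"
      unfolding Bochner_Integration.integral_diff[OF intZ[OF sub0] intZ'[OF sub0]]
      by (simp add: \<delta>_def \<delta>'_def delta1_eq Z_def[abs_def] abs_minus_commute)
    also have "\<dots> \<le> expectation (\<lambda>\<omega>. \<bar>Z (\<lambda>r. r) \<omega> - Z' (\<lambda>r. r) \<omega>\<bar>)"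
      by (rule integral_abs_bound)
    also have "\<dots> \<le> 2 * B / T" by (rule trunc[OF sub0])
    finally show ?thesis .
  qed

  \<comment> \<open>The pairs sharing a label; dissociation decorrelates all others.\<close>
  define R where "R = {(a, b) \<in> A \<times> A. a ` {1..m} \<inter> b ` {1..m} \<noteq> {}}"
  have "real (card R) \<le> real (m\<^sup>2 * n ^ (m - 1) * n ^ m)"
    using card_PiE_pairs_meeting_le[of "{1..m}" "{1..n}"] unfolding R_def A_def
    by (intro of_nat_mono) simp
  also have "\<dots> = (real m)\<^sup>2 * V\<^sup>2 / real n"
    using n_pos by (simp add: V_eq power2_eq_square V_def[symmetric])
  also have "\<dots> \<le> (2 * real d)\<^sup>2 * V\<^sup>2 / real n"
    by (intro divide_right_mono mult_right_mono power_mono) (auto simp: m_def)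
  finally have cardR: "real (card R) \<le> (2 * real d)\<^sup>2 * V\<^sup>2 / real n" .
  have fluct: "expectation (\<lambda>\<omega>. \<bar>(\<Sum>a\<in>A. Z' a \<omega>) - (\<Sum>a\<in>A. expectation (Z' a))\<bar>) \<le> real d * V * (B + 1) / q"
  proof -
    have "expectation (\<lambda>\<omega>. \<bar>(\<Sum>a\<in>A. Z' a \<omega>) - (\<Sum>a\<in>A. expectation (Z' a))\<bar>) \<le> sqrt (T * B * card R)"
    proof (rule expectation_sum_deviation_le[OF finA])
      show "R \<subseteq> A \<times> A" by (auto simp: R_def)
      fix a assume a: "a \<in> A"
      show "random_variable borel (Z' a)" using intZ'[OF sub[OF a]] by simp
      show "integrable M (\<lambda>\<omega>. (Z' a \<omega>)\<^sup>2)" "expectation (\<lambda>\<omega>. (Z' a \<omega>)\<^sup>2) \<le> T * B"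
        unfolding Z'_def B_def
        by (rule integrable_truncated_pair_product_power2[OF T_pos sub[OF a]]
            expectation_truncated_pair_product_power2_le[OF T_pos sub[OF a]])+
    next
      fix a b assume "(a, b) \<in> A \<times> A - R"
      then have "a \<in> A" "b \<in> A" "a ` {1..2 * d - 1} \<inter> b ` {1..2 * d - 1} = {}"
        by (auto simp: R_def m_def)
      then show "expectation (\<lambda>\<omega>. Z' a \<omega> * Z' b \<omega>) = expectation (Z' a) * expectation (Z' b)"
        unfolding Z'_def
        by (intro expectation_pair_product_mult diss sub measurable_truncate abs_truncate_le)
    qed
    also have "\<dots> \<le> real d * V * (B + 1) / q"
    proof (rule real_le_lsqrt)
      have "T * B * card R \<le> T * B * ((2 * real d)\<^sup>2 * V\<^sup>2 / real n)"
        using cardR T_pos B by (intro mult_left_mono) auto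
      also have "\<dots> = (real d * V)\<^sup>2 * (4 * B) / T"
        using T_pos by (simp add: n_eq field_simps power2_eq_square)
      \<comment> \<open>The inequality \<open>4 * B \<le> (B + 1)^2\<close> makes the bound a
        perfect square, as \<open>T\<close> is \<open>q^2\<close>.\<close>
      also have "\<dots> \<le> (real d * V)\<^sup>2 * (B + 1)\<^sup>2 / T"
        using T_pos sum_squares_bound[of B 1]
        by (intro divide_right_mono mult_left_mono) (simp_all add: power2_sum)
      finally show "T * B * card R \<le> (real d * V * (B + 1) / q)\<^sup>2"
        by (simp add: T_def power_divide power_mult_distrib)
    qed (use V_pos B q in auto)
    finally show ?thesis .
  qed

  define D where "D = {a \<in> A. \<not> inj_on a {1..m}}"
  \<comment> \<open>With \<open>x = 2 * d / T\<close>, counting gives \<open>V * x^2\<close> and the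
    trivial bound is \<open>V\<close>. The smaller of the two is at most \<open>V * x\<close>, which
    keeps the estimate linear in \<open>d\<close>.\<close>
  have cardD: "real (card D) \<le> V * (2 * real d / T)"
  proof (cases "1 \<le> 2 * real d / T")
    case True
    have "real (card D) \<le> V * 1"
      using card_mono[OF finA, of D] cardA by (simp add: D_def)
    also have "\<dots> \<le> V * (2 * real d / T)" using True V_pos by (intro mult_left_mono) auto
    finally show ?thesis .
  next
    case False
    have "real (card D) \<le> real (m\<^sup>2 * n ^ (m - 1))"
      using card_PiE_not_inj_le[of "{1..m}" "{1..n}"] unfolding D_def A_def
      by (intro of_nat_mono) simp
    also have "\<dots> \<le> (2 * real d)\<^sup>2 * real n ^ (m - 1)"
      unfolding of_nat_mult of_nat_power
      by (intro mult_right_mono power_mono) (auto simp: m_def)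
    also have "\<dots> = V * ((2 * real d / T) * (2 * real d / T))"
      using T_pos by (simp add: V_eq n_eq power2_eq_square)
    also have "\<dots> \<le> V * ((2 * real d / T) * 1)"
      using False V_pos T_pos by (intro mult_left_mono) auto
    finally show ?thesis by simp
  qed
  \<comment> \<open>Injective \<open>a\<close> contribute nothing by exchangeability; each
    \<open>a\<close> in \<open>D\<close> contributes at most \<open>2 * (B + 1)\<close>.\<close>
  have bias: "\<bar>(\<Sum>a\<in>A. expectation (Z' a)) - V * \<delta>'\<bar> \<le> V * (4 * real d * (B + 1) / T)"
  proof -
    have "(\<Sum>a\<in>A. expectation (Z' a)) - V * \<delta>' = (\<Sum>a\<in>A. expectation (Z' a) - \<delta>')"
      by (simp add: sum_subtractf flip: cardA)
    also have "\<dots> = (\<Sum>a\<in>D. expectation (Z' a) - \<delta>')"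
    proof (rule sum.mono_neutral_right[OF finA])
      show "\<forall>a\<in>A - D. expectation (Z' a) - \<delta>' = 0"
        using expectation_pair_product_inj[OF measurable_truncate sub]
        unfolding \<delta>'_def Z'_def D_def m_def by simp
    qed (simp add: D_def)
    also have "\<bar>\<dots>\<bar> \<le> (\<Sum>a\<in>D. \<bar>expectation (Z' a) - \<delta>'\<bar>)" by (rule sum_abs)
    also have "\<dots> \<le> (\<Sum>a\<in>D. 2 * (B + 1))"
    proof (rule sum_mono)
      fix a assume "a \<in> D"
      then have "a \<in> A" by (simp add: D_def)
      then have "\<bar>expectation (Z' a)\<bar> \<le> B + 1" "\<bar>\<delta>'\<bar> \<le> B + 1"
        unfolding \<delta>'_def Z'_def B_def
        by (intro abs_expectation_pair_product_le abs_truncate_le measurable_truncate sub sub0; assumption)+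
      then show "\<bar>expectation (Z' a) - \<delta>'\<bar> \<le> 2 * (B + 1)"
        using abs_triangle_ineq4[of "expectation (Z' a)" \<delta>'] by simp
    qed
    also have "\<dots> = card D * (2 * (B + 1))" by simp
    also have "\<dots> \<le> V * (2 * real d / T) * (2 * (B + 1))"
      using cardD B by (intro mult_right_mono) auto
    also have "\<dots> = V * (4 * real d * (B + 1) / T)" by (simp add: algebra_simps)
    finally show ?thesis .
  qed

  \<comment> \<open>Successive replacements: \<open>Z\<close> by \<open>Z'\<close>, the sum of
    \<open>Z'\<close> by its expectation, that by \<open>V * \<delta>'\<close>, and finally
    \<open>\<delta>'\<close> by \<open>\<delta>\<close>.\<close>
  have "\<bar>mean_square n d (\<lambda>i. X i \<omega>) - \<delta>\<bar> \<le> ((\<Sum>a\<in>A. \<bar>Z a \<omega> - Z' a \<omega>\<bar>)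
      + \<bar>(\<Sum>a\<in>A. Z' a \<omega>) - (\<Sum>a\<in>A. expectation (Z' a))\<bar>
      + (V * (4 * real d * (B + 1) / T) + V * (2 * B / T))) / V" for \<omega>
  proof -
    have "mean_square n d (\<lambda>i. X i \<omega>) = (\<Sum>a\<in>A. Z a \<omega>) / V"
      by (simp only: mean_square_eq_sum_pair_product[OF d_pos] Z_def A_def m_def V_def)
    then have "\<bar>mean_square n d (\<lambda>i. X i \<omega>) - \<delta>\<bar> = \<bar>(\<Sum>a\<in>A. Z a \<omega>) - V * \<delta>\<bar> / V"
      using V_pos abs_divide[of "(\<Sum>a\<in>A. Z a \<omega>) - V * \<delta>" V] by (simp add: diff_divide_distrib)
    moreover have "\<bar>(\<Sum>a\<in>A. Z a \<omega>) - (\<Sum>a\<in>A. Z' a \<omega>)\<bar> \<le> (\<Sum>a\<in>A. \<bar>Z a \<omega> - Z' a \<omega>\<bar>)"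
      unfolding sum_subtractf[symmetric] by (rule sum_abs)
    moreover have "\<bar>V * \<delta>' - V * \<delta>\<bar> \<le> V * (2 * B / T)"
      using mult_left_mono[OF \<delta>_diff, of V] V_pos by (simp add: abs_mult flip: right_diff_distrib)
    ultimately show ?thesis
      using bias V_pos by (auto intro!: divide_right_mono)
  qed
  then have "osc M n d X \<le> expectation (\<lambda>\<omega>. ((\<Sum>a\<in>A. \<bar>Z a \<omega> - Z' a \<omega>\<bar>)
      + \<bar>(\<Sum>a\<in>A. Z' a \<omega>) - (\<Sum>a\<in>A. expectation (Z' a))\<bar>
      + (V * (4 * real d * (B + 1) / T) + V * (2 * B / T))) / V)"
    unfolding osc_eq \<delta>_def[symmetric]
    using integrable_mean_square intZ intZ' sub
    by (intro integral_mono) (auto intro!: integrable_divide Bochner_Integration.integrable_add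
        Bochner_Integration.integrable_sum Bochner_Integration.integrable_diff integrable_abs)
  also have "\<dots> = ((\<Sum>a\<in>A. expectation (\<lambda>\<omega>. \<bar>Z a \<omega> - Z' a \<omega>\<bar>))
      + expectation (\<lambda>\<omega>. \<bar>(\<Sum>a\<in>A. Z' a \<omega>) - (\<Sum>a\<in>A. expectation (Z' a))\<bar>)
      + (V * (4 * real d * (B + 1) / T) + V * (2 * B / T))) / V"
    using intZ intZ' sub by (simp add: prob_space)
  also have "\<dots> \<le> ((\<Sum>a\<in>A. 2 * B / T) + real d * V * (B + 1) / q
      + (V * (4 * real d * (B + 1) / T) + V * (2 * B / T))) / V"
    using V_pos trunc sub fluct by (intro divide_right_mono add_mono sum_mono) auto
  also have "\<dots> = 4 * B / T + real d * (B + 1) / q + 4 * real d * (B + 1) / T"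
    using V_pos by (simp add: cardA field_simps)
  \<comment> \<open>Since \<open>q \<ge> 1\<close>, the denominator \<open>T = q^2\<close> may be
    weakened to \<open>q\<close>.\<close>
  also have "\<dots> \<le> 4 * B / q + real d * (B + 1) / q + 4 * real d * (B + 1) / q"
    using q B self_le_power[of q 2] unfolding T_def
    by (intro add_mono divide_left_mono) auto
  also have "\<dots> \<le> 16 * real d * (B + 1) / q"
  proof -
    define e where "e = real d * (B + 1)"
    \<comment> \<open>As \<open>d \<ge> 1\<close>, the term \<open>4 * B\<close> is at most
      \<open>4 * e\<close>, so the whole is at most \<open>9 * e\<close>.\<close>
    have "1 * (B + 1) \<le> e" unfolding e_def using d_pos B by (intro mult_right_mono) auto
    then have "4 * B + e + 4 * e \<le> 16 * e" using B by simp
    then have "4 * B + real d * (B + 1) + 4 * real d * (B + 1) \<le> 16 * real d * (B + 1)"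
      by (simp add: e_def mult.assoc)
    then show ?thesis using q by (simp add: divide_right_mono flip: add_divide_distrib)
  qed
  finally show ?thesis by (simp add: B_def q_def)
qed

end

section \<open>Disintegration of expectations over a mixture\<close>

text \<open>Turns the eventwise identity of real probabilities defining a mixture into an equality
  of measures, to which the integration results for \<open>bind\<close> apply.\<close>

lemma tensor_law_mixture:
  assumes "is_mixture M n d X P N Y" and M: "random_tensor M n d X"
  shows "tensor_law M n d X = P \<bind> (\<lambda>w. tensor_law (N w) n d (Y w))"
proof -
  let ?Q = "tensor_space d {1..n}" and ?k = "\<lambda>w. tensor_law (N w) n d (Y w)"
  interpret P: prob_space P using assms(1) by (simp add: is_mixture_def)
  have k: "?k \<in> measurable P (prob_algebra ?Q)" using assms(1) by (simp add: is_mixture_def)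
  have ks: "?k \<in> measurable P (subprob_algebra ?Q)" using k by (rule measurable_prob_algebraD)
  interpret law: prob_space "tensor_law M n d X"
    unfolding tensor_law_def using M
    by (intro prob_space.prob_space_distr measurable_subtensor) (auto simp: random_tensor_def)
  show ?thesis
  proof (rule measure_eqI)
    show "sets (tensor_law M n d X) = sets (P \<bind> ?k)"
      using sets_bind[OF sets_kernel[OF ks] P.not_empty] by (simp add: tensor_law_def)
  next
    fix A assume "A \<in> sets (tensor_law M n d X)"
    then have A: "A \<in> sets ?Q" by (simp add: tensor_law_def)
    have prob: "prob_space (?k w)" if "w \<in> space P" for w
      using measurable_space[OF k that] by (simp add: space_prob_algebra)
    have "(\<lambda>w. measure (?k w) A) \<in> borel_measurable P"
      using measurable_compose[OF ks measurable_measure_subprob_algebra[OF A]] .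
    then have int: "integrable P (\<lambda>w. measure (?k w) A)"
      using prob by (intro P.integrable_const_bound[where B=1]) (auto intro!: prob_space.prob_le_1)
    have "emeasure (tensor_law M n d X) A = ennreal (LINT w|P. measure (?k w) A)"
      using assms(1) A by (simp add: law.emeasure_eq_measure is_mixture_def)
    also have "\<dots> = (\<integral>\<^sup>+w. ennreal (measure (?k w) A) \<partial>P)"
      using int by (intro nn_integral_eq_integral[symmetric]) auto
    also have "\<dots> = (\<integral>\<^sup>+w. emeasure (?k w) A \<partial>P)"
      using prob by (intro nn_integral_cong) (auto simp: finite_measure.emeasure_eq_measure prob_space.finite_measure)
    also have "\<dots> = emeasure (P \<bind> ?k) A"
      using emeasure_bind[OF P.not_empty ks A] by simp
    finally show "emeasure (tensor_law M n d X) A = emeasure (P \<bind> ?k) A" .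
  qed
qed

text \<open>Both sides are rewritten as integrals against tensor laws, where the kernel formula
  applies, and then pulled back to the underlying spaces.\<close>

lemma integral_mixture:
  fixes f :: "((nat \<Rightarrow> nat) \<Rightarrow> real) \<Rightarrow> real"
  assumes mix: "is_mixture M n d X P N Y" and M: "random_tensor M n d X"
    and f: "f \<in> borel_measurable (tensor_space d {1..n})"
    and int: "integrable M (\<lambda>\<omega>. f (subtensor d {1..n} X \<omega>))"
  shows "AE w in P. integrable (N w) (\<lambda>\<omega>. f (subtensor d {1..n} (Y w) \<omega>))"
    and "has_bochner_integral P (\<lambda>w. LINT \<omega>|N w. f (subtensor d {1..n} (Y w) \<omega>))
      (LINT \<omega>|M. f (subtensor d {1..n} X \<omega>))"
proof -
  let ?Q = "tensor_space d {1..n}" and ?k = "\<lambda>w. tensor_law (N w) n d (Y w)"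
  have ks: "?k \<in> measurable P (subprob_algebra ?Q)"
    using mix by (intro measurable_prob_algebraD) (simp add: is_mixture_def)
  have X: "subtensor d {1..n} X \<in> measurable M ?Q"
    using M by (intro measurable_subtensor) (auto simp: random_tensor_def)
  have Y: "subtensor d {1..n} (Y w) \<in> measurable (N w) ?Q" if "w \<in> space P" for w
    using mix that by (intro measurable_subtensor) (auto simp: random_tensor_def is_mixture_def)
  have "integrable (tensor_law M n d X) f"
    unfolding tensor_law_def integrable_distr_eq[OF X f] by (rule int)
  then have "integrable (P \<bind> ?k) f" using tensor_law_mixture[OF mix M] by simp
  note bind = has_bochner_integral_bind[OF ks f this]
  show "AE w in P. integrable (N w) (\<lambda>\<omega>. f (subtensor d {1..n} (Y w) \<omega>))"
  proof (rule AE_mp[OF bind(1)], intro AE_I2 impI)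
    fix w assume "w \<in> space P" "integrable (?k w) f"
    then show "integrable (N w) (\<lambda>\<omega>. f (subtensor d {1..n} (Y w) \<omega>))"
      unfolding tensor_law_def using integrable_distr_eq[OF Y f] by simp
  qed
  have "integral\<^sup>L (P \<bind> ?k) f = (LINT \<omega>|M. f (subtensor d {1..n} X \<omega>))"
    unfolding tensor_law_mixture[OF mix M, symmetric] unfolding tensor_law_def
    by (rule integral_distr[OF X f])
  moreover have "integral\<^sup>L (?k w) f = (LINT \<omega>|N w. f (subtensor d {1..n} (Y w) \<omega>))" if "w \<in> space P" for w
    unfolding tensor_law_def by (rule integral_distr[OF Y[OF that] f])
  ultimately show "has_bochner_integral P (\<lambda>w. LINT \<omega>|N w. f (subtensor d {1..n} (Y w) \<omega>))
      (LINT \<omega>|M. f (subtensor d {1..n} X \<omega>))"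
    using bind(2) by (simp cong: has_bochner_integral_cong)
qed

text \<open>The nonnegative function \<open>?f\<close> vanishes exactly where the entry does. Its
  mean under the mixture is 0, so its mean is 0 in almost every component.\<close>

lemma AE_mixture_eq_0:
  assumes mix: "is_mixture M n d X P N Y" and M: "random_tensor M n d X"
    and i: "i \<in> indices d {1..n}" and "AE \<omega> in M. X i \<omega> = 0"
  shows "AE w in P. AE \<omega> in N w. Y w i \<omega> = 0"
proof -
  let ?f = "\<lambda>y. min 1 \<bar>y i\<bar>"
  have f: "?f \<in> borel_measurable (tensor_space d {1..n})" using i by measurable
  have meas: "X i \<in> borel_measurable M" using M i by (simp add: random_tensor_def)
  have ae: "AE \<omega> in M. ?f (subtensor d {1..n} X \<omega>) = 0" using assms(4) i by auto
  have "integrable M (\<lambda>\<omega>. ?f (subtensor d {1..n} X \<omega>))"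
    using integrable_cong_AE[OF _ _ ae] meas i by simp
  note bochner = integral_mixture[OF mix M f this]
  have "has_bochner_integral P (\<lambda>w. LINT \<omega>|N w. ?f (subtensor d {1..n} (Y w) \<omega>)) 0"
    using bochner(2) integral_eq_zero_AE[OF ae] by simp
  then have "AE w in P. (LINT \<omega>|N w. ?f (subtensor d {1..n} (Y w) \<omega>)) = 0"
    by (subst integral_nonneg_eq_0_iff_AE[symmetric])
      (auto simp: has_bochner_integral_iff intro!: Bochner_Integration.integral_nonneg)
  with bochner(1) show ?thesis
  proof eventually_elim
    case (elim w)
    then have "AE \<omega> in N w. ?f (subtensor d {1..n} (Y w) \<omega>) = 0"
      using integral_nonneg_eq_0_iff_AE[OF elim(1)] by auto
    then show ?case by eventually_elim (use i in \<open>auto simp: min_def split: if_splits\<close>)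
  qed
qed

lemma measurable_mean_square:
  assumes "1 \<le> d"
  shows "mean_square n d \<in> borel_measurable (tensor_space d {1..n})"
proof -
  have "(\<lambda>y. mean_square n d y) \<in> borel_measurable (tensor_space d {1..n})"
    unfolding mean_square_eq_sum_pair_product[OF assms]
    by (intro borel_measurable_divide borel_measurable_sum measurable_pair_product_tensor_space assms) auto
  then show ?thesis by simp
qed

lemma mean_square_subtensor:
  "mean_square n d (subtensor d {1..n} X \<omega>) = mean_square n d (\<lambda>i. X i \<omega>)"
  by (simp add: mean_square_def)

lemma pc_product_subtensor:
  assumes "1 \<le> d" "4 * d \<le> n"
  shows "pair_product d (\<lambda>x. x) (subtensor d {1..n} X \<omega>) (\<lambda>r. r)
      * pair_product d (\<lambda>x. x) (subtensor d {1..n} X \<omega>) (\<lambda>r. 2 * d - 1 + r) = pc_product d X \<omega>"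
proof -
  have "(\<lambda>r. r) ` {1..2 * d - 1} \<subseteq> {1..n}" "(\<lambda>r. 2 * d - 1 + r) ` {1..2 * d - 1} \<subseteq> {1..n}"
    using assms by auto
  then show ?thesis
    by (simp only: pair_product_subtensor[OF assms(1)] pc_product_eq[OF assms(1)])
qed

section \<open>The mixture case\<close>

context exchangeable_tensor
begin

lemma random_tensor: "random_tensor M n d X"
  using prob_space_axioms measurable_entry by (simp add: random_tensor_def)

text \<open>Finite third moments and vanishing diagonal pass from \<open>X\<close> to almost every
  component. There are finitely many indices, so the exceptional null sets can be combined.\<close>

lemma AE_mixture_exchangeable_tensor:
  assumes mix: "is_mixture M n d X P N Y" and exch_Y: "\<And>w. w \<in> space P \<Longrightarrow> exchangeable (N w) n d (Y w)"
  shows "AE w in P. exchangeable_tensor (N w) n d (Y w)"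
proof -
  have fin: "finite (indices d {1..n})" by (simp add: indices_def finite_PiE)
  have "AE w in P. \<forall>i\<in>indices d {1..n}. integrable (N w) (\<lambda>\<omega>. \<bar>Y w i \<omega>\<bar> ^ 3)"
  proof (rule AE_finite_allI[OF fin])
    fix i assume i: "i \<in> indices d {1..n}"
    have "(\<lambda>y. \<bar>y i\<bar> ^ 3) \<in> borel_measurable (tensor_space d {1..n})" using i by measurable
    from integral_mixture(1)[OF mix random_tensor this]
    show "AE w in P. integrable (N w) (\<lambda>\<omega>. \<bar>Y w i \<omega>\<bar> ^ 3)" using i integrable_cube[OF i] by simp
  qed
  moreover have "AE w in P. \<forall>i\<in>{i\<in>indices d {1..n}. \<not> inj_on i {1..d}}. AE \<omega> in N w. Y w i \<omega> = 0"
  proof (rule AE_finite_allI)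
    fix i assume "i \<in> {i\<in>indices d {1..n}. \<not> inj_on i {1..d}}"
    then show "AE w in P. AE \<omega> in N w. Y w i \<omega> = 0"
      using diag by (intro AE_mixture_eq_0[OF mix random_tensor]) (auto simp: diagonal_vanish_def)
  qed (use fin in simp)
  ultimately show ?thesis
  proof (rule AE_mp[OF AE_conjI], intro AE_I2 impI)
    fix w assume w: "w \<in> space P"
      and "(\<forall>i\<in>indices d {1..n}. integrable (N w) (\<lambda>\<omega>. \<bar>Y w i \<omega>\<bar> ^ 3)) \<and>
        (\<forall>i\<in>{i\<in>indices d {1..n}. \<not> inj_on i {1..d}}. AE \<omega> in N w. Y w i \<omega> = 0)"
    then show "exchangeable_tensor (N w) n d (Y w)"
      using mix exch_Y[OF w] d_pos n_ge
      by (auto simp: exchangeable_tensor_def exchangeable_tensor_axioms_def is_mixture_def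
          random_tensor_def diagonal_vanish_def)
  qed
qed

lemma osc_le_of_mixture:
  assumes mix: "is_mixture M n d X P N Y"
    and diss_Y: "\<And>w. w \<in> space P \<Longrightarrow> dissociated (N w) n d (Y w)"
    and exch_Y: "\<And>w. w \<in> space P \<Longrightarrow> exchangeable (N w) n d (Y w)"
    and int_pc: "integrable M (pc_product d X)"
  shows "osc M n d X \<le> sqrt (pc M d X) + 16 * real d * (third_moment + 1) / root 4 (real n)"
proof -
  interpret P: prob_space P using mix by (simp add: is_mixture_def)
  \<comment> \<open>The bound for a component is \<open>c\<close> times its third moment plus 1, so
    averaging over \<open>w\<close> reproduces the same bound with the third moment of
    \<open>X\<close>.\<close>
  define c where "c = 16 * real d / root 4 (real n)"
  define \<delta> where "\<delta> = delta1 M d X"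
  define \<delta>Y where "\<delta>Y w = delta1 (N w) d (Y w)" for w
  let ?X = "subtensor d {1..n} X" and ?Y = "\<lambda>w. subtensor d {1..n} (Y w)"
  let ?i = "tup [1..<d + 1]"
  let ?fB = "\<lambda>y. \<bar>y ?i\<bar> ^ 3"
  let ?f\<delta> = "\<lambda>y. pair_product d (\<lambda>x. x) y (\<lambda>r. r)"
  let ?fpc = "\<lambda>y. ?f\<delta> y * pair_product d (\<lambda>x. x) y (\<lambda>r. 2 * d - 1 + r)"
  \<comment> \<open>Centred at \<open>\<delta>\<close> of the mixture for every component, so that
    its average over \<open>w\<close> is exactly \<open>osc M n d X\<close>.\<close>
  let ?fosc = "\<lambda>y. \<bar>mean_square n d y - \<delta>\<bar>"
  have sub: "(\<lambda>r. r) ` {1..2 * d - 1} \<subseteq> {1..n}" "(\<lambda>r. 2 * d - 1 + r) ` {1..2 * d - 1} \<subseteq> {1..n}"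
    using n_ge by auto
  have i: "?i \<in> indices d {1..n}"
    using first_index_in_indices[OF d_pos sub(1)] first_index_shift[OF d_pos, of 0] by simp
  have c: "0 \<le> c" by (simp add: c_def)
  have ext: "AE w in P. exchangeable_tensor (N w) n d (Y w)"
    by (rule AE_mixture_exchangeable_tensor[OF mix exch_Y])

  have f\<delta>_meas: "?f\<delta> \<in> borel_measurable (tensor_space d {1..n})"
    and "(\<lambda>y. pair_product d (\<lambda>x. x) y (\<lambda>r. 2 * d - 1 + r)) \<in> borel_measurable (tensor_space d {1..n})"
    by (rule measurable_pair_product_tensor_space[OF d_pos sub(1)], simp)
      (rule measurable_pair_product_tensor_space[OF d_pos sub(2)], simp)
  then have fpc_meas: "?fpc \<in> borel_measurable (tensor_space d {1..n})"
    by (rule borel_measurable_times)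
  have fB_meas: "?fB \<in> borel_measurable (tensor_space d {1..n})" using i by measurable
  have fosc_meas: "?fosc \<in> borel_measurable (tensor_space d {1..n})"
    using measurable_mean_square[OF d_pos, of n] by measurable
  \<comment> \<open>Stated separately for \<open>X\<close> and for the components because their
    outcomes have different types.\<close>
  have fpc: "?fpc (subtensor d {1..n} Z \<omega>) = pc_product d Z \<omega>" for Z and \<omega> :: 'a
    by (rule pc_product_subtensor[OF d_pos n_ge])
  have fpcY: "?fpc (subtensor d {1..n} (Y w) \<omega>) = pc_product d (Y w) \<omega>" for w \<omega>
    by (rule pc_product_subtensor[OF d_pos n_ge])

  have "integrable M (\<lambda>\<omega>. ?f\<delta> (?X \<omega>))"
    unfolding pair_product_subtensor[OF d_pos sub(1)] using sub(1) by (intro integrable_pair_product) auto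
  from integral_mixture(2)[OF mix random_tensor f\<delta>_meas this]
  have int_\<delta>: "has_bochner_integral P \<delta>Y \<delta>"
    unfolding pair_product_subtensor[OF d_pos sub(1)]
    by (simp add: delta1_def \<delta>_def \<delta>Y_def[abs_def] pair_product_eq_tup[OF d_pos] del: upt_Suc)
  have "integrable M (\<lambda>\<omega>. ?fB (?X \<omega>))" using integrable_cube[OF i] i by simp
  from integral_mixture(2)[OF mix random_tensor fB_meas this]
  have int_B: "has_bochner_integral P (\<lambda>w. LINT \<omega>|N w. \<bar>Y w ?i \<omega>\<bar> ^ 3) third_moment"
    using i by (simp add: third_moment_def)
  have "integrable M (\<lambda>\<omega>. ?fpc (?X \<omega>))" using int_pc by (simp only: fpc)
  from integral_mixture(2)[OF mix random_tensor fpc_meas this]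
  have int_pcY: "has_bochner_integral P (\<lambda>w. LINT \<omega>|N w. pc_product d (Y w) \<omega>) (expectation (pc_product d X))"
    unfolding fpc fpcY .
  have "integrable M (\<lambda>\<omega>. ?fosc (?X \<omega>))"
    unfolding mean_square_subtensor using integrable_mean_square by simp
  from integral_mixture(2)[OF mix random_tensor fosc_meas this]
  have int_osc: "has_bochner_integral P (\<lambda>w. LINT \<omega>|N w. \<bar>mean_square n d (\<lambda>i. Y w i \<omega>) - \<delta>\<bar>) (osc M n d X)"
    unfolding mean_square_subtensor osc_eq \<delta>_def .

  note [measurable] = borel_measurable_has_bochner_integral[OF int_\<delta>]
  have "AE w in P. (LINT \<omega>|N w. pc_product d (Y w) \<omega>) = (\<delta>Y w)\<^sup>2"
  proof (rule AE_mp[OF ext], intro AE_I2 impI)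
    fix w assume "w \<in> space P" "exchangeable_tensor (N w) n d (Y w)"
    then show "(LINT \<omega>|N w. pc_product d (Y w) \<omega>) = (\<delta>Y w)\<^sup>2"
      using exchangeable_tensor.expectation_pc_product[OF _ diss_Y] by (simp add: \<delta>Y_def)
  qed
  then have int_\<delta>2: "has_bochner_integral P (\<lambda>w. (\<delta>Y w)\<^sup>2) (expectation (pc_product d X))"
    using int_pcY by (subst has_bochner_integral_cong_AE[symmetric])
      (auto dest: borel_measurable_has_bochner_integral)
  \<comment> \<open>The mean of \<open>\<delta>Y\<close> is \<open>\<delta>\<close>, so this is its
    variance; the absolute value of the right-hand side is \<open>pc M d X\<close>.\<close>
  have int_diff2: "has_bochner_integral P (\<lambda>w. (\<delta>Y w - \<delta>)\<^sup>2) (expectation (pc_product d X) - \<delta>\<^sup>2)"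
  proof -
    have "has_bochner_integral P (\<lambda>w. (\<delta>Y w)\<^sup>2 - 2 * \<delta> * \<delta>Y w + \<delta>\<^sup>2)
        (expectation (pc_product d X) - 2 * \<delta> * \<delta> + \<delta>\<^sup>2)"
      using int_\<delta> int_\<delta>2
      by (intro has_bochner_integral_add has_bochner_integral_diff has_bochner_integral_mult_right)
        (simp_all add: has_bochner_integral_iff P.prob_space)
    then show ?thesis by (simp add: power2_diff power2_eq_square algebra_simps)
  qed
  have "P.expectation (\<lambda>w. \<bar>\<delta>Y w - \<delta>\<bar>) \<le> sqrt (P.expectation (\<lambda>w. (\<delta>Y w - \<delta>)\<^sup>2))"
    using int_diff2 by (intro P.expectation_abs_le_sqrt_expectation_power2) (auto simp: has_bochner_integral_iff)
  also have "\<dots> \<le> sqrt (pc M d X)"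
    using int_diff2 by (simp add: has_bochner_integral_iff pc_def \<delta>_def)
  finally have \<delta>_diff: "P.expectation (\<lambda>w. \<bar>\<delta>Y w - \<delta>\<bar>) \<le> sqrt (pc M d X)" .

  have int_bound: "integrable P (\<lambda>w. c * ((LINT \<omega>|N w. \<bar>Y w ?i \<omega>\<bar> ^ 3) + 1) + \<bar>\<delta>Y w - \<delta>\<bar>)"
    using int_B int_\<delta> by (auto simp: has_bochner_integral_iff)
  have "osc M n d X = P.expectation (\<lambda>w. LINT \<omega>|N w. \<bar>mean_square n d (\<lambda>i. Y w i \<omega>) - \<delta>\<bar>)"
    using int_osc by (simp add: has_bochner_integral_iff)
  also have "\<dots> \<le> P.expectation (\<lambda>w. c * ((LINT \<omega>|N w. \<bar>Y w ?i \<omega>\<bar> ^ 3) + 1) + \<bar>\<delta>Y w - \<delta>\<bar>)"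
  proof (rule integral_mono_AE)
    show "integrable P (\<lambda>w. LINT \<omega>|N w. \<bar>mean_square n d (\<lambda>i. Y w i \<omega>) - \<delta>\<bar>)"
      using int_osc by (simp add: has_bochner_integral_iff)
    show "AE w in P. (LINT \<omega>|N w. \<bar>mean_square n d (\<lambda>i. Y w i \<omega>) - \<delta>\<bar>)
        \<le> c * ((LINT \<omega>|N w. \<bar>Y w ?i \<omega>\<bar> ^ 3) + 1) + \<bar>\<delta>Y w - \<delta>\<bar>"
    proof (rule AE_mp[OF ext], intro AE_I2 impI)
      fix w assume w: "w \<in> space P" and "exchangeable_tensor (N w) n d (Y w)"
      then interpret Y: exchangeable_tensor "N w" n d "Y w" by simp
      show "(LINT \<omega>|N w. \<bar>mean_square n d (\<lambda>i. Y w i \<omega>) - \<delta>\<bar>)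
          \<le> c * ((LINT \<omega>|N w. \<bar>Y w ?i \<omega>\<bar> ^ 3) + 1) + \<bar>\<delta>Y w - \<delta>\<bar>"
        using Y.expectation_abs_mean_square_diff_le[of \<delta>] Y.osc_le_of_dissociated[OF diss_Y[OF w]]
        by (simp add: c_def \<delta>Y_def Y.third_moment_def)
    qed
  qed (rule int_bound)
  also have "\<dots> = c * (third_moment + 1) + P.expectation (\<lambda>w. \<bar>\<delta>Y w - \<delta>\<bar>)"
    using int_B int_\<delta> by (simp add: has_bochner_integral_iff P.prob_space)
  also have "\<dots> \<le> c * (third_moment + 1) + sqrt (pc M d X)" using \<delta>_diff by simp
  finally show ?thesis by (simp add: c_def)
qed

end

theorem proposition12p7:
  fixes n d :: nat
    and M :: "'a measure"
    and X :: "(nat \<Rightarrow> nat) \<Rightarrow> 'a \<Rightarrow> real"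
  assumes "n \<ge> 1" and "d \<ge> 1" and "n \<ge> 4 * d"
    and "random_tensor M n d X"
    and "exchangeable M n d X"
    and "symmetric M n d X"
    and "diagonal_vanish M n d X"
    and "\<forall>i\<in>indices d {1..n}. integrable M (\<lambda>\<omega>. \<bar>X i \<omega>\<bar> ^ 3)"
  shows "(dissociated M n d X \<longrightarrow>
            osc M n d X \<le>
              16 * real d * ((LINT \<omega>|M. \<bar>X (tup [1..<d+1]) \<omega>\<bar> ^ 3) + 1) / root 4 (real n)) \<and>
         (\<forall>(P :: 'w measure) (N :: 'w \<Rightarrow> 'b measure) (Y :: 'w \<Rightarrow> (nat \<Rightarrow> nat) \<Rightarrow> 'b \<Rightarrow> real).
            is_mixture M n d X P N Y \<and>
            (\<forall>w\<in>space P. dissociated (N w) n d (Y w) \<and> exchangeable (N w) n d (Y w) \<and>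
                         symmetric (N w) n d (Y w)) \<and>
            integrable M (pc_product d X) \<longrightarrow>
            osc M n d X \<le> sqrt (pc M d X) +
              16 * real d * ((LINT \<omega>|M. \<bar>X (tup [1..<d+1]) \<omega>\<bar> ^ 3) + 1) / root 4 (real n))"
proof -
  interpret exchangeable_tensor M n d X
    using assms by (auto simp: exchangeable_tensor_def exchangeable_tensor_axioms_def random_tensor_def)
  show ?thesis
    using osc_le_of_dissociated osc_le_of_mixture unfolding third_moment_def by blast
qed

end
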